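(* Let $G$ be a (discrete) group, $A$ a *-algebra and $\alpha=(\{A_t\}_{t\in G},\{\alpha_t\}_{t\in G})$ a *-partial action of $G$ on $A$. Consider the conditions: (1) $\alpha$ has a *-globalization. (2) For all $(t,a,b)\in G\times A\times A$ there exists $u\in A_t$ such that, for all $c\in A_{t^{-1}}$, $\alpha_t(c)u=\alpha_t(ca)b$. Then (1) implies (2). If, in addition, for all $s,t\in G$ the *-subalgebras $A_t+A_s$ and $A_t\cap A_s$ are non-degenerate and $A_t$ is assimilative in $A$, then (2) implies (1); moreover, in this last case (these additional hypotheses together with (2)), $\alpha$ has a non-degenerate and minimal *-globalization.
   Context: A *-algebra is an algebra $A$ over $\mathbb{C}$ (no unit and no topology assumed) with a conjugate linear map $a\mapsto a^*$ satisfying $(ab)^*=b^*a^*$ and $a^{**}=a$. A *-ideal of $A$ is a subspace $I\subset A$ with $I^*=I$ and $IA\subset I$. A *-homomorphism is a linear multiplicative map with $\phi(a^* )=\phi(a)^*$. A *-algebra $A$ is non-degenerate if the only $a\in A$ with $aA=\{0\}$ is $a=0$ (equivalently, the only $a$ with $Aa=\{0\}$ is $a=0$). A subset $S$ of a *-algebra $C$ is assimilative in $C$ if every $c\in C$ with $cC\subset S$ belongs to $S$. A set-theoretic partial action of a group $G$ on a set $X$ is a pair $\sigma=(\{X_t\}_{t\in G},\{\sigma_t\}_{t\in G})$ where $X_t\subset X$, $\sigma_t\colon X_{t^{-1}}\to X_t$ is a function, $\sigma_e=\mathrm{id}_X$ (so $X_e=X$), and for all $s,t\in G$, if $x\in X_{t^{-1}}$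 and $\sigma_t(x)\in X_{s^{-1}}$, then $x\in X_{t^{-1}s^{-1}}$ and $\sigma_s(\sigma_t(x))=\sigma_{st}(x)$. It is global if $X_t=X$ for all $t$. A *-partial action of $G$ on a *-algebra $A$ is a set-theoretic partial action $(\{A_t\},\{\alpha_t\})$ of $G$ on $A$ such that each $A_t$ is a *-ideal of $A$ and each $\alpha_t$ is a *-homomorphism; a *-global action is a global *-partial action. A morphism from $(\{A_t\},\{\alpha_t\})$ (on $A$) to $(\{B_t\},\{\beta_t\})$ (on $B$) is a *-homomorphism $f\colon A\to B$ with $f(A_t)\subset B_t$ and $f(\alpha_t(x))=\beta_t(f(x))$ for all $t\in G$, $x\in A_{t^{-1}}$; an isomorphism is a morphism with an inverse morphism. If $\beta$ is a *-global action of $G$ on $B$ and $I$ is a *-ideal of $B$, the restriction $\beta|_I$ is the *-partial action $(\{I\cap\beta_t(I)\}_{t\in G},\{\beta_t|_{I\cap\beta_{t^{-1}}(I)}\}_{t\in G})$ of $G$ on $I$. A *-globalization of $\alpha$ is a 4-tuple $\Xi=(B,\beta,I,\iota)$ where $B$ is a *-algebra, $\beta$ is a *-global action of $G$ on $B$, $I$ is a *-ideal of $B$ and $\iota\colon\alpha\to\beta|_I$ is an isomorphism. $\Xi$ is minimal if $\operatorname{span}\{\beta_t(I)\colon t\in G\}=B$, and non-degenerate if $B$ is non-degenerate. *)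

theory Defs
  imports Complex_Main "HOL-Algebra.Module" "HOL-Algebra.AbelCoset"
begin

section \<open>*-algebras\<close>

definition complex_ring :: "complex ring" where
  "complex_ring = \<lparr>carrier = UNIV, monoid.mult = (*), one = 1, zero = 0, add = (+)\<rparr>"

text \<open>The record inherits a field \<open>one\<close> from the ring record. Nothing below refers to it, so
  the algebras are not assumed to be unital.\<close>

record 'a star_alg = "(complex, 'a) module" +
  star :: "'a \<Rightarrow> 'a"

locale star_algebra = module complex_ring A
  for A :: "('a, 'm) star_alg_scheme" (structure) +
  assumes mult_closed: "\<lbrakk>a \<in> carrier A; b \<in> carrier A\<rbrakk> \<Longrightarrow> a \<otimes> b \<in> carrier A"
    and mult_assoc: "\<lbrakk>a \<in> carrier A; b \<in> carrier A; c \<in> carrier A\<rbrakk>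
          \<Longrightarrow> (a \<otimes> b) \<otimes> c = a \<otimes> (b \<otimes> c)"
    and mult_distr_l: "\<lbrakk>a \<in> carrier A; b \<in> carrier A; c \<in> carrier A\<rbrakk>
          \<Longrightarrow> (a \<oplus> b) \<otimes> c = (a \<otimes> c) \<oplus> (b \<otimes> c)"
    and mult_distr_r: "\<lbrakk>a \<in> carrier A; b \<in> carrier A; c \<in> carrier A\<rbrakk>
          \<Longrightarrow> a \<otimes> (b \<oplus> c) = (a \<otimes> b) \<oplus> (a \<otimes> c)"
    and mult_smult_l: "\<lbrakk>a \<in> carrier A; b \<in> carrier A\<rbrakk> \<Longrightarrow> (z \<odot> a) \<otimes> b = z \<odot> (a \<otimes> b)"
    and mult_smult_r: "\<lbrakk>a \<in> carrier A; b \<in> carrier A\<rbrakk> \<Longrightarrow> a \<otimes> (z \<odot> b) = z \<odot> (a \<otimes> b)"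
    and star_closed: "a \<in> carrier A \<Longrightarrow> star A a \<in> carrier A"
    and star_add: "\<lbrakk>a \<in> carrier A; b \<in> carrier A\<rbrakk> \<Longrightarrow> star A (a \<oplus> b) = star A a \<oplus> star A b"
    and star_smult: "a \<in> carrier A \<Longrightarrow> star A (z \<odot> a) = cnj z \<odot> star A a"
    and star_mult: "\<lbrakk>a \<in> carrier A; b \<in> carrier A\<rbrakk> \<Longrightarrow> star A (a \<otimes> b) = star A b \<otimes> star A a"
    and star_star: "a \<in> carrier A \<Longrightarrow> star A (star A a) = a"

definition star_ideal :: "'a set \<Rightarrow> 'a star_alg \<Rightarrow> bool" where
  "star_ideal I A \<longleftrightarrow> submodule I complex_ring A \<and> star A ` I = I \<and>
     (\<forall>x\<in>I. \<forall>a\<in>carrier A. x \<otimes>\<^bsub>A\<^esub> a \<in> I)"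

definition star_hom :: "'a star_alg \<Rightarrow> 'b star_alg \<Rightarrow> ('a \<Rightarrow> 'b) \<Rightarrow> bool" where
  "star_hom A B f \<longleftrightarrow> f \<in> carrier A \<rightarrow> carrier B \<and>
     (\<forall>a\<in>carrier A. \<forall>b\<in>carrier A. f (a \<oplus>\<^bsub>A\<^esub> b) = f a \<oplus>\<^bsub>B\<^esub> f b) \<and>
     (\<forall>z. \<forall>a\<in>carrier A. f (z \<odot>\<^bsub>A\<^esub> a) = z \<odot>\<^bsub>B\<^esub> f a) \<and>
     (\<forall>a\<in>carrier A. \<forall>b\<in>carrier A. f (a \<otimes>\<^bsub>A\<^esub> b) = f a \<otimes>\<^bsub>B\<^esub> f b) \<and>
     (\<forall>a\<in>carrier A. f (star A a) = star B (f a))"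

definition nondegenerate :: "'a star_alg \<Rightarrow> bool" where
  "nondegenerate A \<longleftrightarrow>
     (\<forall>a\<in>carrier A. (\<forall>x\<in>carrier A. a \<otimes>\<^bsub>A\<^esub> x = \<zero>\<^bsub>A\<^esub>) \<longrightarrow> a = \<zero>\<^bsub>A\<^esub>)"

definition assimilative :: "'a set \<Rightarrow> 'a star_alg \<Rightarrow> bool" where
  "assimilative S C \<longleftrightarrow> S \<subseteq> carrier C \<and>
     (\<forall>c\<in>carrier C. (\<forall>x\<in>carrier C. c \<otimes>\<^bsub>C\<^esub> x \<in> S) \<longrightarrow> c \<in> S)"

definition linear_span :: "'a star_alg \<Rightarrow> 'a set \<Rightarrow> 'a set" where
  "linear_span A S = (\<lambda>N. submodule N complex_ring A) hull S"


section \<open>Partial actions\<close>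

text \<open>A partial action is given by its domains \<open>D t\<close> and by total functions \<open>\<sigma> t\<close>, of which
  only the values on \<open>D (inv t)\<close> are relevant.\<close>

definition partial_action ::
  "('g, 'm) monoid_scheme \<Rightarrow> 'x set \<Rightarrow> ('g \<Rightarrow> 'x set) \<Rightarrow> ('g \<Rightarrow> 'x \<Rightarrow> 'x) \<Rightarrow> bool" where
  "partial_action G X D \<sigma> \<longleftrightarrow>
     (\<forall>t\<in>carrier G. D t \<subseteq> X \<and> \<sigma> t \<in> D (inv\<^bsub>G\<^esub> t) \<rightarrow> D t) \<and>
     D \<one>\<^bsub>G\<^esub> = X \<and> (\<forall>x\<in>X. \<sigma> \<one>\<^bsub>G\<^esub> x = x) \<and>
     (\<forall>s\<in>carrier G. \<forall>t\<in>carrier G. \<forall>x. x \<in> D (inv\<^bsub>G\<^esub> t) \<and> \<sigma> t x \<in> D (inv\<^bsub>G\<^esub> s) \<longrightarrow>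
        x \<in> D (inv\<^bsub>G\<^esub> t \<otimes>\<^bsub>G\<^esub> inv\<^bsub>G\<^esub> s) \<and> \<sigma> s (\<sigma> t x) = \<sigma> (s \<otimes>\<^bsub>G\<^esub> t) x)"

definition star_partial_action ::
  "('g, 'm) monoid_scheme \<Rightarrow> 'a star_alg \<Rightarrow> ('g \<Rightarrow> 'a set) \<Rightarrow> ('g \<Rightarrow> 'a \<Rightarrow> 'a) \<Rightarrow> bool" where
  "star_partial_action G A D \<alpha> \<longleftrightarrow> partial_action G (carrier A) D \<alpha> \<and>
     (\<forall>t\<in>carrier G. star_ideal (D t) A \<and>
        star_hom (A\<lparr>carrier := D (inv\<^bsub>G\<^esub> t)\<rparr>) (A\<lparr>carrier := D t\<rparr>) (\<alpha> t))"

definition star_global_action ::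
  "('g, 'm) monoid_scheme \<Rightarrow> 'b star_alg \<Rightarrow> ('g \<Rightarrow> 'b \<Rightarrow> 'b) \<Rightarrow> bool" where
  "star_global_action G B \<beta> \<longleftrightarrow> star_partial_action G B (\<lambda>t. carrier B) \<beta>"

definition star_morphism ::
  "('g, 'm) monoid_scheme \<Rightarrow>
   'a star_alg \<Rightarrow> ('g \<Rightarrow> 'a set) \<Rightarrow> ('g \<Rightarrow> 'a \<Rightarrow> 'a) \<Rightarrow>
   'b star_alg \<Rightarrow> ('g \<Rightarrow> 'b set) \<Rightarrow> ('g \<Rightarrow> 'b \<Rightarrow> 'b) \<Rightarrow> ('a \<Rightarrow> 'b) \<Rightarrow> bool" where
  "star_morphism G A D \<alpha> B E \<beta> f \<longleftrightarrow> star_hom A B f \<and>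
     (\<forall>t\<in>carrier G. f ` D t \<subseteq> E t \<and> (\<forall>x\<in>D (inv\<^bsub>G\<^esub> t). f (\<alpha> t x) = \<beta> t (f x)))"

definition star_isomorphism ::
  "('g, 'm) monoid_scheme \<Rightarrow>
   'a star_alg \<Rightarrow> ('g \<Rightarrow> 'a set) \<Rightarrow> ('g \<Rightarrow> 'a \<Rightarrow> 'a) \<Rightarrow>
   'b star_alg \<Rightarrow> ('g \<Rightarrow> 'b set) \<Rightarrow> ('g \<Rightarrow> 'b \<Rightarrow> 'b) \<Rightarrow> ('a \<Rightarrow> 'b) \<Rightarrow> bool" where
  "star_isomorphism G A D \<alpha> B E \<beta> f \<longleftrightarrow> star_morphism G A D \<alpha> B E \<beta> f \<and>
     (\<exists>g. star_morphism G B E \<beta> A D \<alpha> g \<and>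
        (\<forall>a\<in>carrier A. g (f a) = a) \<and> (\<forall>b\<in>carrier B. f (g b) = b))"


section \<open>Globalizations\<close>

definition restr_dom ::
  "('g \<Rightarrow> 'b \<Rightarrow> 'b) \<Rightarrow> 'b set \<Rightarrow> 'g \<Rightarrow> 'b set" where
  "restr_dom \<beta> I t = I \<inter> \<beta> t ` I"

definition restr_map ::
  "('g, 'm) monoid_scheme \<Rightarrow> ('g \<Rightarrow> 'b \<Rightarrow> 'b) \<Rightarrow> 'b set \<Rightarrow> 'g \<Rightarrow> 'b \<Rightarrow> 'b" where
  "restr_map G \<beta> I t = restrict (\<beta> t) (I \<inter> \<beta> (inv\<^bsub>G\<^esub> t) ` I)"

definition star_globalization ::
  "('g, 'm) monoid_scheme \<Rightarrow> 'a star_alg \<Rightarrow> ('g \<Rightarrow> 'a set) \<Rightarrow> ('g \<Rightarrow> 'a \<Rightarrow> 'a) \<Rightarrow>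
   'b star_alg \<Rightarrow> ('g \<Rightarrow> 'b \<Rightarrow> 'b) \<Rightarrow> 'b set \<Rightarrow> ('a \<Rightarrow> 'b) \<Rightarrow> bool" where
  "star_globalization G A D \<alpha> B \<beta> I \<iota> \<longleftrightarrow>
     star_algebra B \<and> star_global_action G B \<beta> \<and> star_ideal I B \<and>
     star_isomorphism G A D \<alpha> (B\<lparr>carrier := I\<rparr>) (restr_dom \<beta> I) (restr_map G \<beta> I) \<iota>"

definition minimal_globalization ::
  "('g, 'm) monoid_scheme \<Rightarrow> 'b star_alg \<Rightarrow> ('g \<Rightarrow> 'b \<Rightarrow> 'b) \<Rightarrow> 'b set \<Rightarrow> bool" where
  "minimal_globalization G B \<beta> I \<longleftrightarrow>
     linear_span B (\<Union>t\<in>carrier G. \<beta> t ` I) = carrier B"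

text \<open>HOL cannot quantify over types inside a formula, so the type \<open>'b\<close> containing the enveloping
  algebra is a parameter. The type \<open>'g \<Rightarrow> 'a \<Rightarrow> 'a\<close> is large enough to lose nothing: restricting a
  globalization to the span of the translates of \<open>I\<close> gives a globalization whose carrier is the
  image of the finitely supported functions from \<open>G\<close> to \<open>A\<close>, and hence can be copied into
  that type.\<close>

definition has_star_globalization ::
  "'b itself \<Rightarrow> ('g, 'm) monoid_scheme \<Rightarrow> 'a star_alg \<Rightarrow> ('g \<Rightarrow> 'a set) \<Rightarrow> ('g \<Rightarrow> 'a \<Rightarrow> 'a) \<Rightarrow> bool"
  where
  "has_star_globalization (_ :: 'b itself) G A D \<alpha> \<longleftrightarrow>
     (\<exists>(B :: 'b star_alg) \<beta> I \<iota>. star_globalization G A D \<alpha> B \<beta> I \<iota>)"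

definition multiplier_condition ::
  "('g, 'm) monoid_scheme \<Rightarrow> 'a star_alg \<Rightarrow> ('g \<Rightarrow> 'a set) \<Rightarrow> ('g \<Rightarrow> 'a \<Rightarrow> 'a) \<Rightarrow> bool" where
  "multiplier_condition G A D \<alpha> \<longleftrightarrow>
     (\<forall>t\<in>carrier G. \<forall>a\<in>carrier A. \<forall>b\<in>carrier A. \<exists>u\<in>D t. \<forall>c\<in>D (inv\<^bsub>G\<^esub> t).
        \<alpha> t c \<otimes>\<^bsub>A\<^esub> u = \<alpha> t (c \<otimes>\<^bsub>A\<^esub> a) \<otimes>\<^bsub>A\<^esub> b)"

end

theory Submission
  imports Defs "HOL-Library.FuncSet"
begin

text \<open>
  Let \<open>(B, \<beta>, I, \<iota>)\<close> be a globalization and regard \<open>A = I\<close> as an ideal of \<open>B\<close>. The element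
  \<open>u = \<beta>\<^sub>t(a) b\<close> lies in \<open>I\<close> because \<open>I\<close> is an ideal, and in \<open>\<beta>\<^sub>t(I)\<close> because
  \<open>u = \<beta>\<^sub>t(a \<beta>\<^sub>t\<^sup>-\<^sup>1(b))\<close>. Hence \<open>u \<in> D t\<close>, and
  \<open>\<alpha>\<^sub>t(c) u = \<beta>\<^sub>t(c) \<beta>\<^sub>t(a) b = \<alpha>\<^sub>t(c a) b\<close>. This is the multiplier condition.

  The converse reads this computation backwards. Non-degeneracy of \<open>D s\<close> makes the element \<open>u\<close> of
  the multiplier condition unique, so that there are maps \<open>M\<^sub>s(a) : b \<mapsto> u\<close> on \<open>A\<close>
  (\<open>local_mult s a\<close>), which must be left multiplication by \<open>\<beta>\<^sub>s(a)\<close> in any globalization. They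
  are multipliers of \<open>A\<close>: the adjoint of \<open>M\<^sub>s(a)\<close> is \<open>M\<^sub>s(a\<^sup>*)\<close> (\<open>local_mult_adjoint\<close>). The
  orbit map \<open>a \<mapsto> (s \<mapsto> M\<^sub>s(a))\<close> therefore maps \<open>A\<close> into the *-algebra of all functions from
  \<open>G\<close> to the multiplier algebra of \<open>A\<close>, where \<open>G\<close> acts globally by translation,
  \<open>(\<beta>\<^sub>t f)(s) = f(s t)\<close>. It is injective since \<open>M\<^sub>e(a)\<close> is left multiplication by \<open>a\<close>. The
  enveloping algebra is the span of all translates of the image of \<open>A\<close>; it is realized by concrete
  functions, and no quotient has to be formed. Minimality holds by construction. An element \<open>f\<close> that
  annihilates every translate satisfies \<open>f(s)(x) y = f(s)(x y) = 0\<close> for all \<open>s, x, y\<close>, and so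
  vanishes.

  Three facts turn this into a globalization.
  \<^item> The image of \<open>A\<close> is an ideal, and the span is an algebra, because
    \<open>M\<^sub>s(a) M\<^sub>s\<^sub>t(b) = M\<^sub>s(v)\<close>, where \<open>v \<in> A\<close> is the product of \<open>a\<close> with the multiplier
    \<open>M\<^sub>t(b)\<close> (\<open>local_mult_cross_mult\<close>). The equality is tested against elements of
    \<open>D s \<inter> D (s t)\<close>, a non-degenerate algebra.
  \<^item> The orbit map is equivariant because \<open>M\<^sub>s(\<alpha>\<^sub>t(x)) = M\<^sub>s\<^sub>t(x)\<close> (\<open>local_mult_act\<close>). The two
    sides have values in the different ideals \<open>D s\<close> and \<open>D (s t)\<close>, and they are compared in
    \<open>D s + D (s t)\<close>.
  \<^item> The domain \<open>D t\<close> is not smaller than the domain of the restricted action: if the images of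
    \<open>a\<close> and \<open>b\<close> satisfy \<open>\<iota>(a) = \<beta>\<^sub>t(\<iota>(b))\<close>, then \<open>a y = M\<^sub>t(b) y \<in> D t\<close> for all \<open>y\<close>, and
    \<open>a \<in> D t\<close> since \<open>D t\<close> is assimilative.
\<close>

section \<open>*-algebras, ideals and spans\<close>

lemma complex_ring_simps [simp]:
  "carrier complex_ring = UNIV" "x \<otimes>\<^bsub>complex_ring\<^esub> y = x * y" "\<one>\<^bsub>complex_ring\<^esub> = 1"
  "\<zero>\<^bsub>complex_ring\<^esub> = 0" "x \<oplus>\<^bsub>complex_ring\<^esub> y = x + y"
  by (simp_all add: complex_ring_def)

lemma cring_complex_ring: "cring complex_ring"
proof (rule cringI)
  show "abelian_group complex_ring"
    by (rule abelian_groupI) (auto intro: exI[of _ "- x" for x])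
  show "comm_monoid complex_ring"
    by (rule comm_monoidI) auto
qed (auto simp: distrib_right)

lemma minus_complex_ring [simp]: "\<ominus>\<^bsub>complex_ring\<^esub> z = - z"
proof -
  interpret cring complex_ring by (rule cring_complex_ring)
  show ?thesis using minus_equality[of "- z" z] by simp
qed

text \<open>The law for \<open>0 \<odot> a\<close> makes \<open>(- 1) \<odot> a\<close> an additive inverse of \<open>a\<close>.\<close>

lemma star_algebraI:
  fixes A :: "('a, 'm) star_alg_scheme" (structure)
  assumes "\<And>a b. \<lbrakk>a \<in> carrier A; b \<in> carrier A\<rbrakk> \<Longrightarrow> a \<oplus> b \<in> carrier A"
    and "\<zero> \<in> carrier A"
    and "\<And>a b c. \<lbrakk>a \<in> carrier A; b \<in> carrier A; c \<in> carrier A\<rbrakk> \<Longrightarrow> (a \<oplus> b) \<oplus> c = a \<oplus> (b \<oplus> c)"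
    and "\<And>a b. \<lbrakk>a \<in> carrier A; b \<in> carrier A\<rbrakk> \<Longrightarrow> a \<oplus> b = b \<oplus> a"
    and "\<And>a. a \<in> carrier A \<Longrightarrow> \<zero> \<oplus> a = a"
    and "\<And>z a. a \<in> carrier A \<Longrightarrow> z \<odot> a \<in> carrier A"
    and "\<And>z w a. a \<in> carrier A \<Longrightarrow> (z + w) \<odot> a = z \<odot> a \<oplus> w \<odot> a"
    and "\<And>z a b. \<lbrakk>a \<in> carrier A; b \<in> carrier A\<rbrakk> \<Longrightarrow> z \<odot> (a \<oplus> b) = z \<odot> a \<oplus> z \<odot> b"
    and "\<And>z w a. a \<in> carrier A \<Longrightarrow> (z * w) \<odot> a = z \<odot> (w \<odot> a)"
    and "\<And>a. a \<in> carrier A \<Longrightarrow> 1 \<odot> a = a"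
    and "\<And>a. a \<in> carrier A \<Longrightarrow> 0 \<odot> a = \<zero>"
    and "star_algebra_axioms A"
  shows "star_algebra A"
proof -
  have "abelian_group A"
  proof (rule abelian_groupI)
    fix a assume a: "a \<in> carrier A"
    have "(- 1) \<odot> a \<oplus> a = (- 1 + 1) \<odot> a"
      using assms(7)[OF a, of "-1" 1] assms(10)[OF a] by simp
    then show "\<exists>y\<in>carrier A. y \<oplus> a = \<zero>"
      using a assms(6,11) by auto
  qed (use assms in auto)
  then have "module complex_ring A"
    by (intro moduleI cring_complex_ring) (use assms in auto)
  then show ?thesis
    by (intro star_algebra.intro assms)
qed

context star_algebra
begin

lemma smult_mem [simp, intro]: "x \<in> carrier A \<Longrightarrow> z \<odot> x \<in> carrier A"
  by (simp add: smult_closed)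

lemmas [simp, intro] = mult_closed star_closed
lemmas [simp] = star_star

text \<open>Zero and negatives as scalar multiples: this form lets linear closure conditions avoid
  additive inverses.\<close>

lemma neg_eq_smult: "x \<in> carrier A \<Longrightarrow> \<ominus> x = (- 1) \<odot> x"
  using smult_l_minus[of 1 x] smult_one[of x] by simp

lemma zero_eq_smult: "x \<in> carrier A \<Longrightarrow> \<zero> = 0 \<odot> x"
  using smult_l_null[of x] by simp

lemma add_neg_eq_zero_imp_eq:
  assumes "x \<in> carrier A" "y \<in> carrier A" "x \<oplus> (- 1) \<odot> y = \<zero>"
  shows "x = y"
  using assms neg_eq_smult[of y] by (metis M.add.inv_closed M.minus_equality M.minus_minus)

lemma eq_imp_add_neg_eq_zero: "x \<in> carrier A \<Longrightarrow> x \<oplus> (- 1) \<odot> x = \<zero>"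
  by (metis neg_eq_smult M.r_neg)

lemma zero_mult [simp]: "x \<in> carrier A \<Longrightarrow> \<zero> \<otimes> x = \<zero>"
  by (metis mult_closed mult_smult_l M.zero_closed zero_eq_smult)

lemma mult_zero [simp]: "x \<in> carrier A \<Longrightarrow> x \<otimes> \<zero> = \<zero>"
  by (metis mult_closed mult_smult_r M.zero_closed zero_eq_smult)

lemma star_zero [simp]: "star A \<zero> = \<zero>"
  by (metis complex_cnj_zero star_closed star_smult M.zero_closed zero_eq_smult)

lemma submodule_iff:
  "submodule N complex_ring A \<longleftrightarrow> N \<subseteq> carrier A \<and> \<zero> \<in> N \<and>
     (\<forall>x\<in>N. \<forall>y\<in>N. x \<oplus> y \<in> N) \<and> (\<forall>z. \<forall>x\<in>N. z \<odot> x \<in> N)" (is "_ \<longleftrightarrow> ?R")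
proof
  assume *: "submodule N complex_ring A"
  show ?R
    using submoduleE[OF *] zero_eq_smult by (auto; metis all_not_in_conv subsetD UNIV_I complex_ring_simps(1))
next
  assume ?R then show "submodule N complex_ring A"
    by (intro submoduleI) (auto simp: neg_eq_smult subset_iff)
qed

end

text \<open>The notions of ideal, span and non-degeneracy are stated for algebras without further record
  fields; this locale fixes that type.\<close>

locale plain_star_algebra = star_algebra A for A :: "'a star_alg" (structure)

context plain_star_algebra
begin

lemma submodule_linear_span:
  "S \<subseteq> carrier A \<Longrightarrow> submodule (linear_span A S) complex_ring A"
  unfolding linear_span_def submodule_iff hull_def by blast

lemma linear_span_superset: "S \<subseteq> linear_span A S"
  unfolding linear_span_def by (rule hull_subset)

lemma linear_span_minimal:
  "S \<subseteq> N \<Longrightarrow> submodule N complex_ring A \<Longrightarrow> linear_span A S \<subseteq> N"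
  unfolding linear_span_def by (rule hull_minimal)

lemma linear_span_induct [consumes 1, case_names carrier base zero add smult]:
  assumes "x \<in> linear_span A S" and "S \<subseteq> carrier A"
    and "\<And>x. x \<in> S \<Longrightarrow> P x" and "P \<zero>"
    and "\<And>x y. \<lbrakk>x \<in> carrier A; y \<in> carrier A; P x; P y\<rbrakk> \<Longrightarrow> P (x \<oplus> y)"
    and "\<And>z x. \<lbrakk>x \<in> carrier A; P x\<rbrakk> \<Longrightarrow> P (z \<odot> x)"
  shows "P x"
proof -
  have "linear_span A S \<subseteq> {x \<in> carrier A. P x}"
    by (rule linear_span_minimal) (use assms in \<open>auto simp: submodule_iff\<close>)
  then show ?thesis using assms(1) by auto
qed

lemma star_algebra_restrict_carrier:
  assumes N: "submodule N complex_ring A"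
    and mult: "\<And>x y. \<lbrakk>x \<in> N; y \<in> N\<rbrakk> \<Longrightarrow> x \<otimes> y \<in> N"
    and star: "\<And>x. x \<in> N \<Longrightarrow> star A x \<in> N"
  shows "star_algebra (A\<lparr>carrier := N\<rparr>)"
proof -
  have "N \<subseteq> carrier A" using N by (simp add: submodule_iff)
  then have "star_algebra_axioms (A\<lparr>carrier := N\<rparr>)"
    by unfold_locales (auto simp: mult star mult_assoc mult_distr_l mult_distr_r mult_smult_l
        mult_smult_r star_add star_smult star_mult subset_iff)
  moreover have "module complex_ring (A\<lparr>carrier := N\<rparr>)"
    by (rule submodule.submodule_is_module[OF N module_axioms])
  ultimately show ?thesis by (rule star_algebra.intro[rotated])
qed

lemma star_ideal_iff:
  "star_ideal I A \<longleftrightarrow> I \<subseteq> carrier A \<and> \<zero> \<in> I \<and> (\<forall>x\<in>I. \<forall>y\<in>I. x \<oplus> y \<in> I) \<and>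
     (\<forall>z. \<forall>x\<in>I. z \<odot> x \<in> I) \<and> (\<forall>x\<in>I. star A x \<in> I) \<and> (\<forall>x\<in>I. \<forall>a\<in>carrier A. x \<otimes> a \<in> I)"
proof -
  have "star A ` I = I \<longleftrightarrow> (\<forall>x\<in>I. star A x \<in> I)" if "I \<subseteq> carrier A"
  proof
    assume *: "\<forall>x\<in>I. star A x \<in> I"
    have "x \<in> star A ` I" if "x \<in> I" for x
      using that * \<open>I \<subseteq> carrier A\<close> by (intro image_eqI[of _ _ "star A x"]) auto
    with * show "star A ` I = I" by auto
  qed auto
  then show ?thesis
    unfolding star_ideal_def submodule_iff by blast
qed

text \<open>A right ideal that is closed under the involution is two-sided, since
  \<open>a x = (x\<^sup>* a\<^sup>*)\<^sup>*\<close>.\<close>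

lemma star_ideal_mult_left:
  assumes "star_ideal I A" "a \<in> carrier A" "x \<in> I"
  shows "a \<otimes> x \<in> I"
proof -
  have x: "x \<in> carrier A" and "star A (star A x \<otimes> star A a) \<in> I"
    using assms by (auto simp: star_ideal_iff)
  then show ?thesis using assms(2) by (simp add: star_mult)
qed

text \<open>The form in which non-degeneracy is applied: elements whose difference lies in a
  non-degenerate *-closed set \<open>S\<close> can be distinguished by multiplication with \<open>S\<close> from the left.
  Asking this of the difference lets \<open>S = D s + D t\<close> separate an element of \<open>D s\<close> from one of
  \<open>D t\<close>. The involution exchanges the left-hand form with the right-hand form of the definition.\<close>

lemma nondegenerateD:
  assumes "nondegenerate (A\<lparr>carrier := S\<rparr>)" "S \<subseteq> carrier A"
    and star: "\<And>x. x \<in> S \<Longrightarrow> star A x \<in> S"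
    and diff: "u \<oplus> (- 1) \<odot> v \<in> S" and uv: "u \<in> carrier A" "v \<in> carrier A"
    and eq: "\<And>w. w \<in> S \<Longrightarrow> w \<otimes> u = w \<otimes> v"
  shows "u = v"
proof -
  let ?d = "u \<oplus> (- 1) \<odot> v"
  have d: "?d \<in> carrier A" using uv by simp
  have "star A ?d \<otimes> w = \<zero>" if "w \<in> S" for w
  proof -
    have w: "w \<in> carrier A" "star A w \<in> S" using that assms(2) star by auto
    then have "star A w \<otimes> ?d = star A w \<otimes> v \<oplus> (- 1) \<odot> (star A w \<otimes> v)"
      using uv eq[OF w(2)] by (simp add: mult_distr_r mult_smult_r)
    then have "star A w \<otimes> ?d = \<zero>"
      using uv w by (simp add: eq_imp_add_neg_eq_zero)
    then have "star A (star A w \<otimes> ?d) = \<zero>" by simp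
    then show ?thesis using w d by (simp add: star_mult)
  qed
  then have "star A ?d = \<zero>"
    using assms(1) star[OF diff] by (auto simp: nondegenerate_def)
  then have "?d = \<zero>"
    using d by (metis star_star star_zero)
  then show ?thesis using uv by (rule add_neg_eq_zero_imp_eq[rotated 2])
qed

end

section \<open>Function algebras and multiplier algebras\<close>

definition power_algebra :: "'s set \<Rightarrow> 'a star_alg \<Rightarrow> ('s \<Rightarrow> 'a) star_alg" where
  "power_algebra S M = \<lparr>carrier = S \<rightarrow>\<^sub>E carrier M,
     monoid.mult = (\<lambda>f g. \<lambda>s\<in>S. f s \<otimes>\<^bsub>M\<^esub> g s), one = (\<lambda>s\<in>S. \<one>\<^bsub>M\<^esub>),
     zero = (\<lambda>s\<in>S. \<zero>\<^bsub>M\<^esub>), add = (\<lambda>f g. \<lambda>s\<in>S. f s \<oplus>\<^bsub>M\<^esub> g s),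
     smult = (\<lambda>z f. \<lambda>s\<in>S. z \<odot>\<^bsub>M\<^esub> f s), star = (\<lambda>f. \<lambda>s\<in>S. star M (f s))\<rparr>"

lemma (in plain_star_algebra) star_algebra_power_algebra:
  "star_algebra (power_algebra S A)"
proof -
  have [simp]: "f s \<in> carrier A" if "f \<in> S \<rightarrow>\<^sub>E carrier A" "s \<in> S" for f s
    using that by auto
  have carrier: "carrier (power_algebra S A) = (S \<rightarrow>\<^sub>E carrier A)"
    by (simp add: power_algebra_def)
  have eqI: "f = g" if "f \<in> S \<rightarrow>\<^sub>E carrier A" "g \<in> S \<rightarrow>\<^sub>E carrier A" "\<And>s. s \<in> S \<Longrightarrow> f s = g s" for f g
    using that by (rule PiE_ext)
  have axioms: "star_algebra_axioms (power_algebra S A)"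
    by (unfold_locales; (unfold carrier, rule eqI)?)
      (simp_all add: power_algebra_def mult_assoc mult_distr_l mult_distr_r mult_smult_l
        mult_smult_r star_add star_smult star_mult)
  show ?thesis
    by (intro star_algebraI; (rule axioms | (unfold carrier, rule eqI)?))
      (simp_all add: power_algebra_def M.a_ac smult_l_distr[simplified] smult_r_distr[simplified]
        smult_assoc1[simplified] smult_one[simplified] smult_l_null[simplified])
qed

text \<open>Adjoint pairs are pairs of maps with \<open>\<langle>n x, y\<rangle> = \<langle>x, m y\<rangle>\<close> for the \<open>A\<close>-valued form
  \<open>\<langle>x, y\<rangle> = x\<^sup>* y\<close>.\<close>

definition adjoint_pair :: "'a star_alg \<Rightarrow> ('a \<Rightarrow> 'a) \<Rightarrow> ('a \<Rightarrow> 'a) \<Rightarrow> bool" where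
  "adjoint_pair A m n \<longleftrightarrow> m \<in> carrier A \<rightarrow>\<^sub>E carrier A \<and> n \<in> carrier A \<rightarrow>\<^sub>E carrier A \<and>
     (\<forall>x\<in>carrier A. \<forall>y\<in>carrier A. star A (n x) \<otimes>\<^bsub>A\<^esub> y = star A x \<otimes>\<^bsub>A\<^esub> m y)"

text \<open>The description is justified for adjointable \<open>m\<close> over a non-degenerate \<open>A\<close>, where adjoints are
  unique (\<open>adjoint_pair_unique\<close>).\<close>

definition adjoint :: "'a star_alg \<Rightarrow> ('a \<Rightarrow> 'a) \<Rightarrow> ('a \<Rightarrow> 'a)" where
  "adjoint A m = (THE n. adjoint_pair A m n)"

text \<open>Over a non-degenerate algebra, the existence of an adjoint forces \<open>m\<close> to be linear with
  \<open>m(x y) = m(x) y\<close> (\<open>multiplier_add\<close>, \<open>multiplier_smult\<close>, \<open>multiplier_mult\<close>).\<close>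

definition multiplier_algebra :: "'a star_alg \<Rightarrow> ('a \<Rightarrow> 'a) star_alg" where
  "multiplier_algebra A = \<lparr>carrier = {m. \<exists>n. adjoint_pair A m n},
     monoid.mult = compose (carrier A), one = (\<lambda>x\<in>carrier A. x),
     zero = (\<lambda>x\<in>carrier A. \<zero>\<^bsub>A\<^esub>), add = (\<lambda>m n. \<lambda>x\<in>carrier A. m x \<oplus>\<^bsub>A\<^esub> n x),
     smult = (\<lambda>z m. \<lambda>x\<in>carrier A. z \<odot>\<^bsub>A\<^esub> m x), star = adjoint A\<rparr>"

locale nondegenerate_star_algebra = plain_star_algebra +
  assumes nondegenerate: "nondegenerate A"
begin

lemma nondegenerate_eqI_left:
  assumes "u \<in> carrier A" "v \<in> carrier A" "\<And>w. w \<in> carrier A \<Longrightarrow> w \<otimes> u = w \<otimes> v"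
  shows "u = v"
  using nondegenerateD[of "carrier A" u v] nondegenerate assms by simp

lemma nondegenerate_eqI_right:
  assumes "u \<in> carrier A" "v \<in> carrier A" "\<And>w. w \<in> carrier A \<Longrightarrow> u \<otimes> w = v \<otimes> w"
  shows "u = v"
proof -
  have "star A u = star A v"
  proof (rule nondegenerate_eqI_left)
    fix w assume w: "w \<in> carrier A"
    have "star A (u \<otimes> star A w) = star A (v \<otimes> star A w)" using assms(3) w by simp
    then show "w \<otimes> star A u = w \<otimes> star A v" using assms(1,2) w by (simp add: star_mult)
  qed (use assms in auto)
  then show ?thesis using assms by (metis star_star)
qed

lemma adjoint_pair_closed:
  assumes "adjoint_pair A m n" "x \<in> carrier A"
  shows "m x \<in> carrier A" "n x \<in> carrier A"
  using assms by (auto simp: adjoint_pair_def)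

lemma adjoint_pairD:
  assumes "adjoint_pair A m n" "x \<in> carrier A" "y \<in> carrier A"
  shows "star A (n x) \<otimes> y = star A x \<otimes> m y" and "x \<otimes> m y = star A (n (star A x)) \<otimes> y"
proof -
  have *: "star A (n x) \<otimes> y = star A x \<otimes> m y" if "x \<in> carrier A" for x
    using that assms by (auto simp: adjoint_pair_def)
  show "star A (n x) \<otimes> y = star A x \<otimes> m y" "x \<otimes> m y = star A (n (star A x)) \<otimes> y"
    using *[of x] *[of "star A x"] assms by auto
qed

lemma adjoint_pair_unique:
  assumes m: "adjoint_pair A m n" and m': "adjoint_pair A m n'"
  shows "n = n'"
proof (rule PiE_ext[of _ "carrier A" "\<lambda>_. carrier A"])
  fix x assume x: "x \<in> carrier A"
  have "star A (n x) = star A (n' x)"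
    using x adjoint_pair_closed(2)[OF m x] adjoint_pair_closed(2)[OF m' x]
    by - (rule nondegenerate_eqI_right, simp_all add: adjoint_pairD(1)[OF m x] adjoint_pairD(1)[OF m' x])
  then have "star A (star A (n x)) = star A (star A (n' x))" by simp
  then show "n x = n' x"
    using adjoint_pair_closed(2)[OF m x] adjoint_pair_closed(2)[OF m' x] by simp
qed (use assms in \<open>simp_all add: adjoint_pair_def\<close>)

lemma adjoint_eq: "adjoint_pair A m n \<Longrightarrow> adjoint A m = n"
  unfolding adjoint_def by (blast intro: adjoint_pair_unique)

lemma adjoint_pair_sym:
  assumes "adjoint_pair A m n"
  shows "adjoint_pair A n m"
proof -
  have "star A (m x) \<otimes> y = star A x \<otimes> n y" if "x \<in> carrier A" "y \<in> carrier A" for x y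
  proof -
    have "star A (star A (n y) \<otimes> x) = star A (star A y \<otimes> m x)"
      using adjoint_pairD(1)[OF assms that(2,1)] by simp
    then show ?thesis
      using that assms by (simp add: star_mult adjoint_pair_closed)
  qed
  then show ?thesis using assms by (simp add: adjoint_pair_def)
qed

text \<open>This and the next two lemmas compare both sides after multiplication by \<open>w\<close> from the left,
  where \<open>w m(x) = n(w\<^sup>*)\<^sup>* x\<close> is visibly linear in \<open>x\<close> and compatible with right multiplication.\<close>

lemma multiplier_add:
  assumes m: "adjoint_pair A m n" and x: "x \<in> carrier A" "y \<in> carrier A"
  shows "m (x \<oplus> y) = m x \<oplus> m y"
proof (rule nondegenerate_eqI_left)
  fix w assume w: "w \<in> carrier A"
  show "w \<otimes> m (x \<oplus> y) = w \<otimes> (m x \<oplus> m y)"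
    using w x adjoint_pair_closed[OF m] by (simp add: mult_distr_r adjoint_pairD(2)[OF m])
qed (use x adjoint_pair_closed[OF m] in auto)

lemma multiplier_smult:
  assumes m: "adjoint_pair A m n" and x: "x \<in> carrier A"
  shows "m (z \<odot> x) = z \<odot> m x"
proof (rule nondegenerate_eqI_left)
  fix w assume w: "w \<in> carrier A"
  show "w \<otimes> m (z \<odot> x) = w \<otimes> (z \<odot> m x)"
    using w x adjoint_pair_closed[OF m] by (simp add: mult_smult_r adjoint_pairD(2)[OF m])
qed (use x adjoint_pair_closed[OF m] in auto)

lemma multiplier_mult:
  assumes m: "adjoint_pair A m n" and x: "x \<in> carrier A" "y \<in> carrier A"
  shows "m (x \<otimes> y) = m x \<otimes> y"
proof (rule nondegenerate_eqI_left)
  fix w assume w: "w \<in> carrier A"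
  have "w \<otimes> m (x \<otimes> y) = (w \<otimes> m x) \<otimes> y"
    using w x adjoint_pair_closed[OF m] by (simp add: mult_assoc adjoint_pairD(2)[OF m])
  then show "w \<otimes> m (x \<otimes> y) = w \<otimes> (m x \<otimes> y)"
    using w x adjoint_pair_closed[OF m] by (simp add: mult_assoc)
qed (use x adjoint_pair_closed[OF m] in auto)

lemma adjoint_pair_plus:
  assumes m: "adjoint_pair A m n" and m': "adjoint_pair A m' n'"
  shows "adjoint_pair A (\<lambda>x\<in>carrier A. m x \<oplus> m' x) (\<lambda>x\<in>carrier A. n x \<oplus> n' x)"
  using adjoint_pair_closed[OF m] adjoint_pair_closed[OF m'] adjoint_pairD(1)[OF m]
    adjoint_pairD(1)[OF m']
  by (auto simp: adjoint_pair_def star_add mult_distr_l mult_distr_r)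

lemma adjoint_pair_scale:
  assumes m: "adjoint_pair A m n"
  shows "adjoint_pair A (\<lambda>x\<in>carrier A. z \<odot> m x) (\<lambda>x\<in>carrier A. cnj z \<odot> n x)"
  using adjoint_pair_closed[OF m] adjoint_pairD(1)[OF m]
  by (auto simp: adjoint_pair_def star_smult mult_smult_l mult_smult_r)

lemma adjoint_pair_compose:
  assumes m: "adjoint_pair A m n" and m': "adjoint_pair A m' n'"
  shows "adjoint_pair A (compose (carrier A) m m') (compose (carrier A) n' n)"
  using adjoint_pair_closed[OF m] adjoint_pair_closed[OF m'] adjoint_pairD(1)[OF m]
    adjoint_pairD(1)[OF m']
  by (auto simp: adjoint_pair_def compose_def)

lemma adjoint_pair_zero: "adjoint_pair A (\<lambda>x\<in>carrier A. \<zero>) (\<lambda>x\<in>carrier A. \<zero>)"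
  by (auto simp: adjoint_pair_def)

lemma multiplier_carrierE:
  assumes "m \<in> carrier (multiplier_algebra A)"
  obtains n where "adjoint_pair A m n" "star (multiplier_algebra A) m = n"
  using assms by (auto simp: multiplier_algebra_def dest: adjoint_eq)

lemma star_algebra_multiplier_algebra: "star_algebra (multiplier_algebra A)"
proof -
  let ?M = "multiplier_algebra A"
  have closed: "m x \<in> carrier A" if "m \<in> carrier ?M" "x \<in> carrier A" for m x
    using that by (auto simp: multiplier_algebra_def adjoint_pair_def)
  have eqI: "m = n"
    if "m \<in> carrier ?M" "n \<in> carrier ?M" "\<And>x. x \<in> carrier A \<Longrightarrow> m x = n x" for m n
    by (rule PiE_ext[of _ "carrier A" "\<lambda>_. carrier A"])
      (use that in \<open>auto simp: multiplier_algebra_def adjoint_pair_def\<close>)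
  have add: "m \<oplus>\<^bsub>?M\<^esub> m' \<in> carrier ?M" "star ?M (m \<oplus>\<^bsub>?M\<^esub> m') = star ?M m \<oplus>\<^bsub>?M\<^esub> star ?M m'"
    and mult: "m \<otimes>\<^bsub>?M\<^esub> m' \<in> carrier ?M" "star ?M (m \<otimes>\<^bsub>?M\<^esub> m') = star ?M m' \<otimes>\<^bsub>?M\<^esub> star ?M m"
    if m: "m \<in> carrier ?M" and m': "m' \<in> carrier ?M" for m m'
  proof -
    obtain n where n: "adjoint_pair A m n" "star ?M m = n" using m by (rule multiplier_carrierE)
    obtain n' where n': "adjoint_pair A m' n'" "star ?M m' = n'" using m' by (rule multiplier_carrierE)
    note sum = adjoint_pair_plus[OF n(1) n'(1)] and prod = adjoint_pair_compose[OF n(1) n'(1)]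
    show "m \<oplus>\<^bsub>?M\<^esub> m' \<in> carrier ?M" "m \<otimes>\<^bsub>?M\<^esub> m' \<in> carrier ?M"
      using sum prod by (auto simp: multiplier_algebra_def)
    show "star ?M (m \<oplus>\<^bsub>?M\<^esub> m') = star ?M m \<oplus>\<^bsub>?M\<^esub> star ?M m'"
      "star ?M (m \<otimes>\<^bsub>?M\<^esub> m') = star ?M m' \<otimes>\<^bsub>?M\<^esub> star ?M m"
      using adjoint_eq[OF sum] adjoint_eq[OF prod] n(2) n'(2)
      by (simp_all add: multiplier_algebra_def)
  qed
  have smult: "z \<odot>\<^bsub>?M\<^esub> m \<in> carrier ?M" "star ?M (z \<odot>\<^bsub>?M\<^esub> m) = cnj z \<odot>\<^bsub>?M\<^esub> star ?M m"
    and star: "star ?M m \<in> carrier ?M" "star ?M (star ?M m) = m"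
    and add_arg: "m (x \<oplus> y) = m x \<oplus> m y" and smult_arg: "m (z \<odot> x) = z \<odot> m x"
    if m: "m \<in> carrier ?M" and x: "x \<in> carrier A" "y \<in> carrier A" for m z x y
  proof -
    obtain n where n: "adjoint_pair A m n" "star ?M m = n" using m by (rule multiplier_carrierE)
    note scale = adjoint_pair_scale[OF n(1), of z] and sym = adjoint_pair_sym[OF n(1)]
    show "z \<odot>\<^bsub>?M\<^esub> m \<in> carrier ?M" "star ?M m \<in> carrier ?M"
      using scale sym n(2) by (auto simp: multiplier_algebra_def)
    show "star ?M (z \<odot>\<^bsub>?M\<^esub> m) = cnj z \<odot>\<^bsub>?M\<^esub> star ?M m" "star ?M (star ?M m) = m"
      using adjoint_eq[OF scale] adjoint_eq[OF sym] n(2) by (simp_all add: multiplier_algebra_def)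
    show "m (x \<oplus> y) = m x \<oplus> m y" "m (z \<odot> x) = z \<odot> m x"
      using multiplier_add[OF n(1) x] multiplier_smult[OF n(1) x(1)] by simp_all
  qed
  have zero: "\<zero>\<^bsub>?M\<^esub> \<in> carrier ?M"
    using adjoint_pair_zero by (auto simp: multiplier_algebra_def)
  note smult = smult[OF _ M.zero_closed M.zero_closed] and star = star[OF _ M.zero_closed M.zero_closed]
  note closed_ops = add mult smult star zero
  have apply_ops: "x \<in> carrier A \<Longrightarrow> (m \<oplus>\<^bsub>?M\<^esub> m') x = m x \<oplus> m' x"
    "x \<in> carrier A \<Longrightarrow> (m \<otimes>\<^bsub>?M\<^esub> m') x = m (m' x)"
    "x \<in> carrier A \<Longrightarrow> (z \<odot>\<^bsub>?M\<^esub> m) x = z \<odot> m x"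
    "x \<in> carrier A \<Longrightarrow> \<zero>\<^bsub>?M\<^esub> x = \<zero>" for m m' z x
    by (simp_all add: multiplier_algebra_def compose_eq)
  have axioms: "star_algebra_axioms ?M"
  proof
    fix m m' z assume m: "m \<in> carrier ?M" and m': "m' \<in> carrier ?M"
    note [simp] = closed[OF m] closed[OF m'] add_arg[OF m] smult_arg[OF m _ M.zero_closed]
    show "m \<otimes>\<^bsub>?M\<^esub> m' \<in> carrier ?M" "star ?M (m \<otimes>\<^bsub>?M\<^esub> m') = star ?M m' \<otimes>\<^bsub>?M\<^esub> star ?M m"
      "star ?M (m \<oplus>\<^bsub>?M\<^esub> m') = star ?M m \<oplus>\<^bsub>?M\<^esub> star ?M m'"
      "star ?M m \<in> carrier ?M" "star ?M (star ?M m) = m"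
      "star ?M (z \<odot>\<^bsub>?M\<^esub> m) = cnj z \<odot>\<^bsub>?M\<^esub> star ?M m"
      using m m' by (simp_all add: closed_ops)
    show "z \<odot>\<^bsub>?M\<^esub> m \<otimes>\<^bsub>?M\<^esub> m' = z \<odot>\<^bsub>?M\<^esub> (m \<otimes>\<^bsub>?M\<^esub> m')" for z
      using m m' by (intro eqI closed_ops) (simp_all add: apply_ops)
    show "m \<otimes>\<^bsub>?M\<^esub> (z \<odot>\<^bsub>?M\<^esub> m') = z \<odot>\<^bsub>?M\<^esub> (m \<otimes>\<^bsub>?M\<^esub> m')" for z
      using m m' by (intro eqI closed_ops) (simp_all add: apply_ops)
    fix m'' assume m'': "m'' \<in> carrier ?M"
    note [simp] = closed[OF m'']
    show "m \<otimes>\<^bsub>?M\<^esub> m' \<otimes>\<^bsub>?M\<^esub> m'' = m \<otimes>\<^bsub>?M\<^esub> (m' \<otimes>\<^bsub>?M\<^esub> m'')"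
      "(m \<oplus>\<^bsub>?M\<^esub> m') \<otimes>\<^bsub>?M\<^esub> m'' = m \<otimes>\<^bsub>?M\<^esub> m'' \<oplus>\<^bsub>?M\<^esub> m' \<otimes>\<^bsub>?M\<^esub> m''"
      "m \<otimes>\<^bsub>?M\<^esub> (m' \<oplus>\<^bsub>?M\<^esub> m'') = m \<otimes>\<^bsub>?M\<^esub> m' \<oplus>\<^bsub>?M\<^esub> m \<otimes>\<^bsub>?M\<^esub> m''"
      using m m' m'' by (auto intro!: eqI closed_ops simp: apply_ops)
  qed
  show ?thesis
  proof (rule star_algebraI)
    fix m m' z w assume m: "m \<in> carrier ?M" and m': "m' \<in> carrier ?M"
    note [simp] = closed[OF m] closed[OF m']
    show "m \<oplus>\<^bsub>?M\<^esub> m' \<in> carrier ?M" "z \<odot>\<^bsub>?M\<^esub> m \<in> carrier ?M"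
      using m m' by (simp_all add: closed_ops)
    show "m \<oplus>\<^bsub>?M\<^esub> m' = m' \<oplus>\<^bsub>?M\<^esub> m" "z \<odot>\<^bsub>?M\<^esub> (m \<oplus>\<^bsub>?M\<^esub> m') = z \<odot>\<^bsub>?M\<^esub> m \<oplus>\<^bsub>?M\<^esub> z \<odot>\<^bsub>?M\<^esub> m'"
      "(z + w) \<odot>\<^bsub>?M\<^esub> m = z \<odot>\<^bsub>?M\<^esub> m \<oplus>\<^bsub>?M\<^esub> w \<odot>\<^bsub>?M\<^esub> m"
      "(z * w) \<odot>\<^bsub>?M\<^esub> m = z \<odot>\<^bsub>?M\<^esub> (w \<odot>\<^bsub>?M\<^esub> m)"
      "\<zero>\<^bsub>?M\<^esub> \<oplus>\<^bsub>?M\<^esub> m = m" "1 \<odot>\<^bsub>?M\<^esub> m = m" "0 \<odot>\<^bsub>?M\<^esub> m = \<zero>\<^bsub>?M\<^esub>"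
      using m m' by (auto intro!: eqI closed_ops simp: apply_ops M.a_comm smult_l_distr[simplified]
          smult_r_distr[simplified] smult_assoc1[simplified] smult_one[simplified]
          smult_l_null[simplified])
    fix m'' assume m'': "m'' \<in> carrier ?M"
    note [simp] = closed[OF m'']
    show "m \<oplus>\<^bsub>?M\<^esub> m' \<oplus>\<^bsub>?M\<^esub> m'' = m \<oplus>\<^bsub>?M\<^esub> (m' \<oplus>\<^bsub>?M\<^esub> m'')"
      using m m' m'' by (auto intro!: eqI closed_ops simp: apply_ops M.a_assoc)
  qed (rule zero, rule axioms)
qed

end

section \<open>Partial actions\<close>

locale star_partial_system = G: group G + plain_star_algebra A
  for G :: "('g, 'm) monoid_scheme" and A :: "'a star_alg" (structure) +
  fixes D :: "'g \<Rightarrow> 'a set" and \<alpha> :: "'g \<Rightarrow> 'a \<Rightarrow> 'a"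
  assumes partial_action: "star_partial_action G A D \<alpha>"
begin

lemma dom_ideal: "t \<in> carrier G \<Longrightarrow> star_ideal (D t) A"
  using partial_action by (simp add: star_partial_action_def)

lemma dom_closed:
  assumes "t \<in> carrier G"
  shows dom_carrier: "\<And>x. x \<in> D t \<Longrightarrow> x \<in> carrier A"
    and dom_add: "\<And>x y. \<lbrakk>x \<in> D t; y \<in> D t\<rbrakk> \<Longrightarrow> x \<oplus> y \<in> D t"
    and dom_smult: "\<And>z x. x \<in> D t \<Longrightarrow> z \<odot> x \<in> D t"
    and dom_star: "\<And>x. x \<in> D t \<Longrightarrow> star A x \<in> D t"
    and dom_mult_right: "\<And>x a. \<lbrakk>x \<in> D t; a \<in> carrier A\<rbrakk> \<Longrightarrow> x \<otimes> a \<in> D t"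
    and dom_mult_left: "\<And>x a. \<lbrakk>x \<in> D t; a \<in> carrier A\<rbrakk> \<Longrightarrow> a \<otimes> x \<in> D t"
  using dom_ideal[OF assms] star_ideal_mult_left[OF dom_ideal[OF assms]]
  by (auto simp: star_ideal_iff)

lemma dom_one: "D \<one>\<^bsub>G\<^esub> = carrier A"
  using partial_action by (simp add: star_partial_action_def partial_action_def)

lemma act_one: "x \<in> carrier A \<Longrightarrow> \<alpha> \<one>\<^bsub>G\<^esub> x = x"
  using partial_action by (simp add: star_partial_action_def partial_action_def)

lemma act_hom:
  assumes "t \<in> carrier G" and x: "x \<in> D (inv\<^bsub>G\<^esub> t)"
  shows act_closed: "\<alpha> t x \<in> D t"
    and act_smult: "\<alpha> t (z \<odot> x) = z \<odot> \<alpha> t x"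
    and act_star: "\<alpha> t (star A x) = star A (\<alpha> t x)"
    and act_add: "y \<in> D (inv\<^bsub>G\<^esub> t) \<Longrightarrow> \<alpha> t (x \<oplus> y) = \<alpha> t x \<oplus> \<alpha> t y"
    and act_mult: "y \<in> D (inv\<^bsub>G\<^esub> t) \<Longrightarrow> \<alpha> t (x \<otimes> y) = \<alpha> t x \<otimes> \<alpha> t y"
proof -
  have "star_hom (A\<lparr>carrier := D (inv\<^bsub>G\<^esub> t)\<rparr>) (A\<lparr>carrier := D t\<rparr>) (\<alpha> t)"
    using partial_action assms(1) by (simp add: star_partial_action_def)
  then show "\<alpha> t x \<in> D t" "\<alpha> t (z \<odot> x) = z \<odot> \<alpha> t x" "\<alpha> t (star A x) = star A (\<alpha> t x)"
    "y \<in> D (inv\<^bsub>G\<^esub> t) \<Longrightarrow> \<alpha> t (x \<oplus> y) = \<alpha> t x \<oplus> \<alpha> t y"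
    "y \<in> D (inv\<^bsub>G\<^esub> t) \<Longrightarrow> \<alpha> t (x \<otimes> y) = \<alpha> t x \<otimes> \<alpha> t y"
    using x by (auto simp: star_hom_def)
qed

lemma act_comp:
  assumes "s \<in> carrier G" "t \<in> carrier G" "x \<in> D (inv\<^bsub>G\<^esub> t)" "\<alpha> t x \<in> D (inv\<^bsub>G\<^esub> s)"
  shows "x \<in> D (inv\<^bsub>G\<^esub> (s \<otimes>\<^bsub>G\<^esub> t))" and "\<alpha> s (\<alpha> t x) = \<alpha> (s \<otimes>\<^bsub>G\<^esub> t) x"
proof -
  have "\<forall>s\<in>carrier G. \<forall>t\<in>carrier G. \<forall>x. x \<in> D (inv\<^bsub>G\<^esub> t) \<and> \<alpha> t x \<in> D (inv\<^bsub>G\<^esub> s) \<longrightarrow>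
      x \<in> D (inv\<^bsub>G\<^esub> t \<otimes>\<^bsub>G\<^esub> inv\<^bsub>G\<^esub> s) \<and> \<alpha> s (\<alpha> t x) = \<alpha> (s \<otimes>\<^bsub>G\<^esub> t) x"
    using partial_action unfolding star_partial_action_def partial_action_def by blast
  then show "x \<in> D (inv\<^bsub>G\<^esub> (s \<otimes>\<^bsub>G\<^esub> t))" "\<alpha> s (\<alpha> t x) = \<alpha> (s \<otimes>\<^bsub>G\<^esub> t) x"
    using assms by (auto simp: G.inv_mult_group)
qed

lemma act_inv_act:
  assumes "t \<in> carrier G" "x \<in> D (inv\<^bsub>G\<^esub> t)"
  shows "\<alpha> (inv\<^bsub>G\<^esub> t) (\<alpha> t x) = x"
  using act_comp(2)[of "inv\<^bsub>G\<^esub> t" t x] assms act_closed[OF assms] act_one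
    dom_carrier[of "inv\<^bsub>G\<^esub> t" x] by simp

lemma act_act_inv:
  assumes "t \<in> carrier G" "x \<in> D t"
  shows "\<alpha> t (\<alpha> (inv\<^bsub>G\<^esub> t) x) = x"
  using act_inv_act[of "inv\<^bsub>G\<^esub> t" x] assms by simp

lemma act_inv_closed: "\<lbrakk>t \<in> carrier G; x \<in> D t\<rbrakk> \<Longrightarrow> \<alpha> (inv\<^bsub>G\<^esub> t) x \<in> D (inv\<^bsub>G\<^esub> t)"
  using act_closed[of "inv\<^bsub>G\<^esub> t" x] by simp

text \<open>The composition axiom, applied to \<open>s t\<close> and \<open>t\<^sup>-\<^sup>1\<close> at the point \<open>\<alpha>\<^sub>t(x)\<close>, yields the
  converse inclusion of domains: \<open>\<alpha>\<^sub>t\<close> maps \<open>D (t\<^sup>-\<^sup>1) \<inter> D ((s t)\<^sup>-\<^sup>1)\<close> into \<open>D (s\<^sup>-\<^sup>1)\<close>.\<close>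

lemma act_inter:
  assumes "s \<in> carrier G" "t \<in> carrier G" "x \<in> D (inv\<^bsub>G\<^esub> t)" "x \<in> D (inv\<^bsub>G\<^esub> (s \<otimes>\<^bsub>G\<^esub> t))"
  shows "\<alpha> t x \<in> D (inv\<^bsub>G\<^esub> s)" and "\<alpha> s (\<alpha> t x) = \<alpha> (s \<otimes>\<^bsub>G\<^esub> t) x"
proof -
  have "inv\<^bsub>G\<^esub> (s \<otimes>\<^bsub>G\<^esub> t \<otimes>\<^bsub>G\<^esub> inv\<^bsub>G\<^esub> t) = inv\<^bsub>G\<^esub> s"
    using assms(1,2) by (simp add: G.m_assoc)
  then show *: "\<alpha> t x \<in> D (inv\<^bsub>G\<^esub> s)"
    using act_comp(1)[of "s \<otimes>\<^bsub>G\<^esub> t" "inv\<^bsub>G\<^esub> t" "\<alpha> t x"] assms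
    by (simp add: act_inv_act act_closed)
  show "\<alpha> s (\<alpha> t x) = \<alpha> (s \<otimes>\<^bsub>G\<^esub> t) x"
    using act_comp(2)[OF assms(1-3) *] .
qed

lemma dom_inter_preimage:
  assumes "s \<in> carrier G" "t \<in> carrier G" "w \<in> D s" "w \<in> D (s \<otimes>\<^bsub>G\<^esub> t)"
  obtains e where "e \<in> D (inv\<^bsub>G\<^esub> s)" "e \<in> D t" "\<alpha> s e = w"
proof (rule that)
  show "\<alpha> (inv\<^bsub>G\<^esub> s) w \<in> D (inv\<^bsub>G\<^esub> s)" "\<alpha> s (\<alpha> (inv\<^bsub>G\<^esub> s) w) = w"
    using assms by (simp_all add: act_inv_closed act_act_inv)
  show "\<alpha> (inv\<^bsub>G\<^esub> s) w \<in> D t"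
    using act_inter(1)[of "inv\<^bsub>G\<^esub> t" "inv\<^bsub>G\<^esub> s" w] assms by (simp add: G.inv_mult_group)
qed

text \<open>Together with \<open>dom_inter_preimage\<close> this is the standard identity
  \<open>\<alpha>\<^sub>s(D (s\<^sup>-\<^sup>1) \<inter> D t) = D s \<inter> D (s t)\<close>.\<close>

lemma act_dom_inter:
  assumes "s \<in> carrier G" "t \<in> carrier G" "e \<in> D (inv\<^bsub>G\<^esub> s)" "e \<in> D t"
  shows "\<alpha> s e \<in> D (s \<otimes>\<^bsub>G\<^esub> t)"
proof -
  have e: "\<alpha> (inv\<^bsub>G\<^esub> t) e \<in> D (inv\<^bsub>G\<^esub> t)" "\<alpha> t (\<alpha> (inv\<^bsub>G\<^esub> t) e) = e"
    using assms by (simp_all add: act_inv_closed act_act_inv)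
  then show ?thesis
    using act_comp[of s t "\<alpha> (inv\<^bsub>G\<^esub> t) e"] act_closed[of "s \<otimes>\<^bsub>G\<^esub> t" "\<alpha> (inv\<^bsub>G\<^esub> t) e"] assms
    by simp
qed

end

section \<open>Globalizations satisfy the multiplier condition\<close>

lemma (in star_partial_system) star_globalization_imp_multiplier_condition:
  assumes glob: "star_globalization G A D \<alpha> B \<beta> I \<iota>"
  shows "multiplier_condition G A D \<alpha>"
  unfolding multiplier_condition_def
proof (intro ballI)
  have I: "star_ideal I B" and action: "star_global_action G B \<beta>" and "star_algebra B"
    and iso: "star_isomorphism G A D \<alpha> (B\<lparr>carrier := I\<rparr>) (restr_dom \<beta> I) (restr_map G \<beta> I) \<iota>"
    using glob by (auto simp: star_globalization_def)
  interpret B: plain_star_algebra B by (rule plain_star_algebra.intro) fact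
  interpret \<beta>: star_partial_system G B "\<lambda>_. carrier B" \<beta>
    by unfold_locales (use action in \<open>simp add: star_global_action_def\<close>)
  obtain g where g: "star_morphism G (B\<lparr>carrier := I\<rparr>) (restr_dom \<beta> I) (restr_map G \<beta> I) A D \<alpha> g"
    and g_inv: "\<And>a. a \<in> carrier A \<Longrightarrow> g (\<iota> a) = a" "\<And>b. b \<in> I \<Longrightarrow> \<iota> (g b) = b"
    using iso by (auto simp: star_isomorphism_def)
  have \<iota>: "\<iota> a \<in> I" "\<iota> (a \<otimes> b) = \<iota> a \<otimes>\<^bsub>B\<^esub> \<iota> b" if "a \<in> carrier A" "b \<in> carrier A" for a b
    using iso that by (auto simp: star_isomorphism_def star_morphism_def star_hom_def)
  have \<iota>_act: "\<iota> (\<alpha> t c) = \<beta> t (\<iota> c)" if t: "t \<in> carrier G" and c: "c \<in> D (inv\<^bsub>G\<^esub> t)" for t c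
  proof -
    have "\<iota> c \<in> restr_dom \<beta> I (inv\<^bsub>G\<^esub> t)" "\<iota> (\<alpha> t c) = restr_map G \<beta> I t (\<iota> c)"
      using iso t c by (auto simp: star_isomorphism_def star_morphism_def)
    then show ?thesis by (simp add: restr_dom_def restr_map_def)
  qed
  have I_sub: "I \<subseteq> carrier B" using I by (simp add: B.star_ideal_iff)
  fix t a b assume t: "t \<in> carrier G" and ab: "a \<in> carrier A" "b \<in> carrier A"
  have \<iota>ab: "\<iota> a \<in> carrier B" "\<iota> b \<in> carrier B" using \<iota>(1) ab I_sub by auto
  define w where "w = \<beta> t (\<iota> a) \<otimes>\<^bsub>B\<^esub> \<iota> b"
  have \<beta>a: "\<beta> t (\<iota> a) \<in> carrier B" using \<beta>.act_closed t \<iota>ab by simp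
  have \<beta>b: "\<beta> (inv\<^bsub>G\<^esub> t) (\<iota> b) \<in> carrier B" using \<beta>.act_closed t \<iota>ab by simp
  have w_I: "w \<in> I"
    using B.star_ideal_mult_left[OF I \<beta>a] \<iota>(1) ab by (simp add: w_def)
  have "w = \<beta> t (\<iota> a \<otimes>\<^bsub>B\<^esub> \<beta> (inv\<^bsub>G\<^esub> t) (\<iota> b))"
    using t \<iota>ab \<beta>b by (simp add: w_def \<beta>.act_mult \<beta>.act_act_inv)
  moreover have "\<iota> a \<otimes>\<^bsub>B\<^esub> \<beta> (inv\<^bsub>G\<^esub> t) (\<iota> b) \<in> I"
    using I \<iota>(1) ab \<beta>b by (simp add: B.star_ideal_iff)
  ultimately have "w \<in> restr_dom \<beta> I t"
    using w_I by (auto simp: restr_dom_def)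
  then have gw: "g w \<in> D t"
    using g t by (auto simp: star_morphism_def)
  show "\<exists>u\<in>D t. \<forall>c\<in>D (inv\<^bsub>G\<^esub> t). \<alpha> t c \<otimes> u = \<alpha> t (c \<otimes> a) \<otimes> b"
  proof (intro bexI[of _ "g w"] ballI gw)
    fix c assume c: "c \<in> D (inv\<^bsub>G\<^esub> t)"
    have cc: "c \<in> carrier A" "c \<otimes> a \<in> D (inv\<^bsub>G\<^esub> t)"
      using c t ab dom_carrier[of "inv\<^bsub>G\<^esub> t"] dom_mult_right[of "inv\<^bsub>G\<^esub> t"] by auto
    have act: "\<alpha> t c \<in> carrier A" "\<alpha> t (c \<otimes> a) \<in> carrier A" "g w \<in> carrier A"
      using t c cc gw act_closed dom_carrier by blast+
    have \<iota>c: "\<iota> c \<in> carrier B" using \<iota>(1) cc I_sub by auto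
    have \<beta>c: "\<beta> t (\<iota> c) \<in> carrier B" using \<beta>.act_closed t \<iota>c by simp
    have "\<iota> (\<alpha> t c \<otimes> g w) = \<beta> t (\<iota> c) \<otimes>\<^bsub>B\<^esub> w"
      using act t c w_I by (simp add: \<iota> \<iota>_act g_inv)
    also have "\<dots> = \<beta> t (\<iota> (c \<otimes> a)) \<otimes>\<^bsub>B\<^esub> \<iota> b"
      using t \<iota>ab \<iota>c \<beta>a \<beta>c cc ab by (simp add: w_def \<iota> \<beta>.act_mult B.mult_assoc)
    also have "\<dots> = \<iota> (\<alpha> t (c \<otimes> a) \<otimes> b)"
      using act t cc ab by (simp add: \<iota> \<iota>_act)
    finally have "g (\<iota> (\<alpha> t c \<otimes> g w)) = g (\<iota> (\<alpha> t (c \<otimes> a) \<otimes> b))" by simp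
    then show "\<alpha> t c \<otimes> g w = \<alpha> t (c \<otimes> a) \<otimes> b"
      using act ab by (simp add: g_inv)
  qed
qed

section \<open>Local multipliers\<close>

locale globalizable_system = star_partial_system G A D \<alpha>
  for G :: "('g, 'm) monoid_scheme" and A :: "'a star_alg" (structure)
    and D :: "'g \<Rightarrow> 'a set" and \<alpha> :: "'g \<Rightarrow> 'a \<Rightarrow> 'a" +
  assumes sum_nondegenerate: "\<And>s t. \<lbrakk>s \<in> carrier G; t \<in> carrier G\<rbrakk> \<Longrightarrow>
      nondegenerate (A\<lparr>carrier := D t <+>\<^bsub>A\<^esub> D s\<rparr>)"
    and inter_nondegenerate: "\<And>s t. \<lbrakk>s \<in> carrier G; t \<in> carrier G\<rbrakk> \<Longrightarrow>
      nondegenerate (A\<lparr>carrier := D t \<inter> D s\<rparr>)"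
    and dom_assimilative: "\<And>t. t \<in> carrier G \<Longrightarrow> assimilative (D t) A"
    and multiplier_condition: "multiplier_condition G A D \<alpha>"

sublocale globalizable_system \<subseteq> nondegenerate_star_algebra A
  by unfold_locales (use inter_nondegenerate[of "\<one>\<^bsub>G\<^esub>" "\<one>\<^bsub>G\<^esub>"] in \<open>simp add: dom_one\<close>)

context globalizable_system
begin

lemma inter_eqI:
  assumes st: "s \<in> carrier G" "t \<in> carrier G"
    and "u \<in> D s" "u \<in> D t" "v \<in> D s" "v \<in> D t"
    and "\<And>w. \<lbrakk>w \<in> D s; w \<in> D t\<rbrakk> \<Longrightarrow> w \<otimes> u = w \<otimes> v"
  shows "u = v"
  by (rule nondegenerateD[OF inter_nondegenerate[OF st(2,1)]])
    (use assms in \<open>auto intro: dom_closed\<close>)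

lemma dom_eqI:
  assumes t: "t \<in> carrier G" and uv: "u \<in> D t" "v \<in> D t"
    and eq: "\<And>c. c \<in> D (inv\<^bsub>G\<^esub> t) \<Longrightarrow> \<alpha> t c \<otimes> u = \<alpha> t c \<otimes> v"
  shows "u = v"
proof (rule inter_eqI[OF t t uv(1,1) uv(2,2)])
  fix w assume "w \<in> D t"
  then show "w \<otimes> u = w \<otimes> v"
    using eq[of "\<alpha> (inv\<^bsub>G\<^esub> t) w"] t by (simp add: act_inv_closed act_act_inv)
qed

text \<open>An element of \<open>D s\<close> and one of \<open>D t\<close> can be compared even if neither ideal contains both:
  their difference lies in \<open>D s + D t\<close>.\<close>

lemma sum_eqI:
  assumes st: "s \<in> carrier G" "t \<in> carrier G" and uv: "u \<in> D s" "v \<in> D t"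
    and "\<And>w. w \<in> D s \<Longrightarrow> w \<otimes> u = w \<otimes> v" "\<And>w. w \<in> D t \<Longrightarrow> w \<otimes> u = w \<otimes> v"
  shows "u = v"
proof (rule nondegenerateD[OF sum_nondegenerate[OF st(2,1)]])
  have c: "u \<in> carrier A" "v \<in> carrier A" using assms by (auto intro: dom_carrier)
  then show "u \<in> carrier A" "v \<in> carrier A" by auto
  show "D s <+>\<^bsub>A\<^esub> D t \<subseteq> carrier A"
    using st by (auto simp: set_add_def' intro: dom_carrier)
  show "star A x \<in> D s <+>\<^bsub>A\<^esub> D t" if "x \<in> D s <+>\<^bsub>A\<^esub> D t" for x
    using that st by (force simp: set_add_def' star_add dom_carrier dest: dom_star)
  show "u \<oplus> - 1 \<odot> v \<in> D s <+>\<^bsub>A\<^esub> D t"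
    using st uv by (auto simp: set_add_def' intro: dom_smult)
  show "w \<otimes> u = w \<otimes> v" if "w \<in> D s <+>\<^bsub>A\<^esub> D t" for w
    using that assms c by (auto simp: set_add_def' mult_distr_l dom_carrier)
qed

text \<open>The element \<open>u\<close> of the multiplier condition as a function of \<open>b\<close>: the action on \<open>A\<close> of the
  element \<open>\<beta>\<^sub>s(a)\<close> of a globalization.\<close>

definition local_mult :: "'g \<Rightarrow> 'a \<Rightarrow> 'a \<Rightarrow> 'a" where
  "local_mult s a b = (THE u. u \<in> D s \<and> (\<forall>c\<in>D (inv\<^bsub>G\<^esub> s). \<alpha> s c \<otimes> u = \<alpha> s (c \<otimes> a) \<otimes> b))"

lemma local_mult_unique:
  assumes s: "s \<in> carrier G" and u: "u \<in> D s"
    and eq: "\<And>c. c \<in> D (inv\<^bsub>G\<^esub> s) \<Longrightarrow> \<alpha> s c \<otimes> u = \<alpha> s (c \<otimes> a) \<otimes> b"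
  shows "local_mult s a b = u"
  unfolding local_mult_def
proof (rule the_equality)
  show "v = u" if "v \<in> D s \<and> (\<forall>c\<in>D (inv\<^bsub>G\<^esub> s). \<alpha> s c \<otimes> v = \<alpha> s (c \<otimes> a) \<otimes> b)" for v
    by (rule dom_eqI[OF s]) (use that u eq in auto)
qed (use u eq in auto)

lemma
  assumes s: "s \<in> carrier G" and ab: "a \<in> carrier A" "b \<in> carrier A"
  shows local_mult_dom: "local_mult s a b \<in> D s"
    and act_local_mult:
      "c \<in> D (inv\<^bsub>G\<^esub> s) \<Longrightarrow> \<alpha> s c \<otimes> local_mult s a b = \<alpha> s (c \<otimes> a) \<otimes> b"
proof -
  obtain u where u: "u \<in> D s" "\<And>c. c \<in> D (inv\<^bsub>G\<^esub> s) \<Longrightarrow> \<alpha> s c \<otimes> u = \<alpha> s (c \<otimes> a) \<otimes> b"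
    using multiplier_condition s ab unfolding multiplier_condition_def by blast
  have eq: "local_mult s a b = u" by (rule local_mult_unique[OF s u])
  show "local_mult s a b \<in> D s"
    and "c \<in> D (inv\<^bsub>G\<^esub> s) \<Longrightarrow> \<alpha> s c \<otimes> local_mult s a b = \<alpha> s (c \<otimes> a) \<otimes> b"
    unfolding eq by (rule u)+
qed

lemma local_mult_closed [simp]:
  "\<lbrakk>s \<in> carrier G; a \<in> carrier A; b \<in> carrier A\<rbrakk> \<Longrightarrow> local_mult s a b \<in> carrier A"
  using local_mult_dom dom_carrier by blast

lemma local_mult_one:
  assumes "a \<in> carrier A" "b \<in> carrier A"
  shows "local_mult \<one>\<^bsub>G\<^esub> a b = a \<otimes> b"
  by (rule local_mult_unique) (use assms in \<open>simp_all add: dom_one act_one mult_assoc\<close>)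

lemma act_carrier [simp]:
  "\<lbrakk>s \<in> carrier G; c \<in> D (inv\<^bsub>G\<^esub> s)\<rbrakk> \<Longrightarrow> \<alpha> s c \<in> carrier A"
  using act_closed dom_carrier by blast

lemma dom_mult_inv:
  "\<lbrakk>s \<in> carrier G; c \<in> D (inv\<^bsub>G\<^esub> s); a \<in> carrier A\<rbrakk> \<Longrightarrow> c \<otimes> a \<in> D (inv\<^bsub>G\<^esub> s)"
  by (simp add: dom_mult_right)

lemma local_mult_mult:
  assumes s: "s \<in> carrier G" and "a \<in> carrier A" "b \<in> carrier A" "y \<in> carrier A"
  shows "local_mult s (a \<otimes> b) y = local_mult s a (local_mult s b y)"
proof (rule local_mult_unique[OF s])
  fix c assume c: "c \<in> D (inv\<^bsub>G\<^esub> s)"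
  then have "c \<in> carrier A" using s dom_carrier[of "inv\<^bsub>G\<^esub> s"] by simp
  then show "\<alpha> s c \<otimes> local_mult s a (local_mult s b y) = \<alpha> s (c \<otimes> (a \<otimes> b)) \<otimes> y"
    using assms c by (simp add: act_local_mult dom_mult_inv mult_assoc[symmetric])
qed (use assms in \<open>simp add: local_mult_dom\<close>)

lemma local_mult_add:
  assumes s: "s \<in> carrier G" and "a \<in> carrier A" "b \<in> carrier A" "y \<in> carrier A"
  shows "local_mult s (a \<oplus> b) y = local_mult s a y \<oplus> local_mult s b y"
proof (rule local_mult_unique[OF s])
  fix c assume c: "c \<in> D (inv\<^bsub>G\<^esub> s)"
  then have "c \<in> carrier A" using s dom_carrier[of "inv\<^bsub>G\<^esub> s"] by simp
  then show "\<alpha> s c \<otimes> (local_mult s a y \<oplus> local_mult s b y) = \<alpha> s (c \<otimes> (a \<oplus> b)) \<otimes> y"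
    using assms c
    by (simp add: act_local_mult dom_mult_inv mult_distr_r mult_distr_l act_add)
qed (use assms in \<open>simp add: local_mult_dom dom_add\<close>)

lemma local_mult_smult:
  assumes s: "s \<in> carrier G" and "a \<in> carrier A" "y \<in> carrier A"
  shows "local_mult s (z \<odot> a) y = z \<odot> local_mult s a y"
proof (rule local_mult_unique[OF s])
  fix c assume c: "c \<in> D (inv\<^bsub>G\<^esub> s)"
  then have "c \<in> carrier A" using s dom_carrier[of "inv\<^bsub>G\<^esub> s"] by simp
  then show "\<alpha> s c \<otimes> (z \<odot> local_mult s a y) = \<alpha> s (c \<otimes> (z \<odot> a)) \<otimes> y"
    using assms c
    by (simp add: act_local_mult dom_mult_inv mult_smult_r mult_smult_l act_smult)
qed (use assms in \<open>simp add: local_mult_dom dom_smult\<close>)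

text \<open>On \<open>D s\<close> the multiplier is given by an explicit formula: translate to \<open>D (s\<^sup>-\<^sup>1)\<close>, multiply
  by \<open>a\<close>, and translate back.\<close>

lemma local_mult_on_dom:
  assumes s: "s \<in> carrier G" and d: "d \<in> D (inv\<^bsub>G\<^esub> s)" and a: "a \<in> carrier A"
  shows "local_mult s a (\<alpha> s d) = \<alpha> s (a \<otimes> d)"
proof (rule local_mult_unique[OF s])
  have ad: "a \<otimes> d \<in> D (inv\<^bsub>G\<^esub> s)" using s d a by (simp add: dom_mult_left)
  show "\<alpha> s (a \<otimes> d) \<in> D s" using s ad by (rule act_closed)
  fix c assume c: "c \<in> D (inv\<^bsub>G\<^esub> s)"
  then have "c \<in> carrier A" "d \<in> carrier A" using s d dom_carrier[of "inv\<^bsub>G\<^esub> s"] by auto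
  then show "\<alpha> s c \<otimes> \<alpha> s (a \<otimes> d) = \<alpha> s (c \<otimes> a) \<otimes> \<alpha> s d"
    using s a d c ad by (simp add: act_mult[symmetric] dom_mult_inv mult_assoc)
qed

lemma local_mult_right_mult:
  assumes s: "s \<in> carrier G" and "a \<in> carrier A" "y \<in> carrier A" "z \<in> carrier A"
  shows "local_mult s a (y \<otimes> z) = local_mult s a y \<otimes> z"
  by (rule local_mult_unique[OF s])
    (use assms in \<open>simp_all add: local_mult_dom dom_mult_right dom_mult_inv act_local_mult
      flip: mult_assoc\<close>)

text \<open>Both sides lie in \<open>D s\<close>, so it suffices to multiply by \<open>w \<in> D s\<close> from the right. Then
  \<open>y w \<in> D s\<close> as well, and the explicit formula for \<open>M\<^sub>s(a)\<close> on \<open>D s\<close> applies to \<open>M\<^sub>s(a)(y w)\<close>.\<close>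

lemma local_mult_adjoint:
  assumes s: "s \<in> carrier G" and a: "a \<in> carrier A" and xy: "x \<in> carrier A" "y \<in> carrier A"
  shows "star A (local_mult s (star A a) x) \<otimes> y = star A x \<otimes> local_mult s a y"
    (is "star A ?p \<otimes> y = star A x \<otimes> ?q")
proof -
  have p: "?p \<in> D s" "?p \<in> carrier A" and q: "?q \<in> D s" "?q \<in> carrier A"
    using assms by (simp_all add: local_mult_dom)
  \<comment> \<open>The adjoint relation for \<open>y = \<alpha>\<^sub>s(d)\<close>: apply the involution to the defining property of
    \<open>?p\<close> at \<open>c = d\<^sup>*\<close>.\<close>
  have p_act: "star A ?p \<otimes> \<alpha> s d = star A x \<otimes> \<alpha> s (a \<otimes> d)" if d: "d \<in> D (inv\<^bsub>G\<^esub> s)" for d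
  proof -
    have d': "star A d \<in> D (inv\<^bsub>G\<^esub> s)" "d \<in> carrier A" "a \<otimes> d \<in> D (inv\<^bsub>G\<^esub> s)"
      using s d a dom_carrier[of "inv\<^bsub>G\<^esub> s"] by (auto intro: dom_star dom_mult_left)
    have "star A (\<alpha> s (star A d) \<otimes> ?p) = star A (\<alpha> s (star A d \<otimes> star A a) \<otimes> x)"
      using s a xy d' by (simp add: act_local_mult)
    moreover have "\<alpha> s (star A d \<otimes> star A a) = star A (\<alpha> s (a \<otimes> d))"
      using s a d' by (simp add: star_mult[symmetric] act_star)
    ultimately show ?thesis
      using s a xy d d' p by (simp add: star_mult act_star)
  qed
  have "star A (star A ?p \<otimes> y) = star A (star A x \<otimes> ?q)"
  proof (rule dom_eqI[OF s])
    show "star A (star A ?p \<otimes> y) \<in> D s" "star A (star A x \<otimes> ?q) \<in> D s"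
      using s xy p q by (auto intro: dom_star dom_mult_left dom_mult_right)
    fix c assume c: "c \<in> D (inv\<^bsub>G\<^esub> s)"
    \<comment> \<open>Left multiplication by \<open>\<alpha>\<^sub>s(c)\<close> after the involution is right multiplication by \<open>w\<close>
      before it.\<close>
    define w where "w = star A (\<alpha> s c)"
    have w: "w \<in> D s" "w \<in> carrier A" "\<alpha> s c = star A w"
      using s c by (auto simp: w_def intro: dom_star act_closed)
    have "y \<otimes> w \<in> D s" using s w xy by (auto intro: dom_mult_left)
    then obtain d where d: "d \<in> D (inv\<^bsub>G\<^esub> s)" "\<alpha> s d = y \<otimes> w"
      using s act_act_inv act_inv_closed by metis
    have "star A ?p \<otimes> y \<otimes> w = star A x \<otimes> \<alpha> s (a \<otimes> d)"
      using p_act[OF d(1)] d(2) p xy w by (simp add: mult_assoc)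
    also have "\<dots> = star A x \<otimes> local_mult s a (y \<otimes> w)"
      using local_mult_on_dom[OF s d(1) a] d(2) by simp
    also have "\<dots> = star A x \<otimes> ?q \<otimes> w"
      using s a xy w q by (simp add: local_mult_right_mult mult_assoc)
    finally have "star A (star A ?p \<otimes> y \<otimes> w) = star A (star A x \<otimes> ?q \<otimes> w)" by simp
    then show "\<alpha> s c \<otimes> star A (star A ?p \<otimes> y) = \<alpha> s c \<otimes> star A (star A x \<otimes> ?q)"
      using p q xy w by (simp add: star_mult[of _ w])
  qed
  then have "star A (star A (star A ?p \<otimes> y)) = star A (star A (star A x \<otimes> ?q))" by simp
  then show ?thesis using p q xy by simp
qed

text \<open>With \<open>r = s t\<close>, the left side \<open>p\<close> lies in \<open>D s\<close> and the right side \<open>q\<close> in \<open>D r\<close>. First,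
  \<open>w p = w q\<close> for \<open>w \<in> D s \<inter> D r\<close>: such \<open>w\<close> have the form \<open>\<alpha>\<^sub>r(k) = \<alpha>\<^sub>s(\<alpha>\<^sub>t(k))\<close>, and both
  products equal \<open>\<alpha>\<^sub>r(k x) y\<close>. For \<open>v\<close> in \<open>D s\<close> or in \<open>D r\<close>, the products \<open>v p\<close> and \<open>v q\<close> both lie
  in \<open>D s \<inter> D r\<close>, where they can be compared by multiplying with such \<open>w\<close>. Non-degeneracy of
  \<open>D s + D r\<close> then gives \<open>p = q\<close>.\<close>

lemma local_mult_act:
  assumes s: "s \<in> carrier G" and t: "t \<in> carrier G"
    and x: "x \<in> D (inv\<^bsub>G\<^esub> t)" and y: "y \<in> carrier A"
  shows "local_mult s (\<alpha> t x) y = local_mult (s \<otimes>\<^bsub>G\<^esub> t) x y"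
proof -
  define r where "r = s \<otimes>\<^bsub>G\<^esub> t"
  have r: "r \<in> carrier G" "inv\<^bsub>G\<^esub> s \<in> carrier G" "inv\<^bsub>G\<^esub> t \<in> carrier G" "inv\<^bsub>G\<^esub> r \<in> carrier G"
    using s t by (simp_all add: r_def)
  let ?p = "local_mult s (\<alpha> t x) y" and ?q = "local_mult r x y"
  have x': "x \<in> carrier A" "\<alpha> t x \<in> D t" "\<alpha> t x \<in> carrier A"
    using x t r by (auto intro: dom_carrier act_closed)
  have p: "?p \<in> D s" "?p \<in> carrier A" and q: "?q \<in> D r" "?q \<in> carrier A"
    using s t r x' y by (auto intro: local_mult_dom local_mult_closed)
  have inter: "w \<otimes> ?p = w \<otimes> ?q" if w: "w \<in> D s" "w \<in> D r" for w
  proof -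
    obtain e where e: "e \<in> D (inv\<^bsub>G\<^esub> s)" "e \<in> D t" "\<alpha> s e = w"
      using dom_inter_preimage[OF s t] w unfolding r_def by blast
    define k where "k = \<alpha> (inv\<^bsub>G\<^esub> t) e"
    have k: "k \<in> D (inv\<^bsub>G\<^esub> t)" "\<alpha> t k = e" "k \<in> carrier A"
      using t e(2) r by (auto simp: k_def act_inv_closed act_act_inv intro: dom_carrier[of "inv\<^bsub>G\<^esub> t"])
    have k': "k \<in> D (inv\<^bsub>G\<^esub> r)" "\<alpha> r k = w"
      using act_comp[OF s t k(1)] k e by (simp_all add: r_def)
    have kx: "k \<otimes> x \<in> D (inv\<^bsub>G\<^esub> t)" "k \<otimes> x \<in> D (inv\<^bsub>G\<^esub> r)"
      using k k' x' r by (auto intro: dom_mult_right)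
    have "w \<otimes> ?p = \<alpha> s (e \<otimes> \<alpha> t x) \<otimes> y"
      using s e x' y by (simp flip: e(3) add: act_local_mult)
    also have "e \<otimes> \<alpha> t x = \<alpha> t (k \<otimes> x)"
      using t k x by (simp add: act_mult)
    also have "\<alpha> s \<dots> = \<alpha> r (k \<otimes> x)"
      using act_inter(2)[OF s t kx(1)] kx(2) by (simp add: r_def)
    also have "\<dots> \<otimes> y = w \<otimes> ?q"
      using r k' x' y by (simp flip: k'(2) add: act_local_mult)
    finally show ?thesis .
  qed
  have "?p = ?q"
  proof (rule sum_eqI[OF s r(1) p(1) q(1)])
    fix v assume v: "v \<in> D s"
    then have vc: "v \<in> carrier A" using s dom_carrier by blast
    obtain c where c: "c \<in> D (inv\<^bsub>G\<^esub> s)" "v = \<alpha> s c"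
      using v s act_act_inv act_inv_closed by metis
    have "\<alpha> s (c \<otimes> \<alpha> t x) \<in> D r"
      unfolding r_def
      by (rule act_dom_inter) (use s t c r x' dom_carrier[of "inv\<^bsub>G\<^esub> s" c] in \<open>auto intro: dom_mult_right dom_mult_left\<close>)
    \<comment> \<open>\<open>?p\<close> itself is not known to lie in \<open>D r\<close> at this point.\<close>
    then have "v \<otimes> ?p \<in> D r"
      using c s x' y r by (simp add: act_local_mult dom_mult_right)
    then show "v \<otimes> ?p = v \<otimes> ?q"
    proof (rule inter_eqI[OF s r(1), rotated])
      fix w assume w: "w \<in> D s" "w \<in> D r"
      then have "w \<in> carrier A" using s dom_carrier by blast
      then show "w \<otimes> (v \<otimes> ?p) = w \<otimes> (v \<otimes> ?q)"
        using inter[of "w \<otimes> v"] w v vc s r p q by (simp add: dom_mult_right mult_assoc)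
    qed (use s r v vc p q in \<open>auto intro: dom_mult_right dom_mult_left\<close>)
  next
    fix v assume v: "v \<in> D r"
    then have vc: "v \<in> carrier A" using r dom_carrier by blast
    obtain c where c: "c \<in> D (inv\<^bsub>G\<^esub> r)" "v = \<alpha> r c"
      using v r act_act_inv act_inv_closed by metis
    have "\<alpha> r (c \<otimes> x) \<in> D (r \<otimes>\<^bsub>G\<^esub> inv\<^bsub>G\<^esub> t)"
      by (rule act_dom_inter) (use s t c r x x' dom_carrier[of "inv\<^bsub>G\<^esub> r" c] in \<open>auto intro: dom_mult_right dom_mult_left\<close>)
    then have "\<alpha> r (c \<otimes> x) \<in> D s"
      using s t by (simp add: r_def G.m_assoc)
    \<comment> \<open>The mirror image: \<open>?q\<close> is not yet known to lie in \<open>D s\<close>.\<close>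
    then have "v \<otimes> ?q \<in> D s"
      using c s x' y r by (simp add: act_local_mult dom_mult_right)
    then show "v \<otimes> ?p = v \<otimes> ?q"
    proof (rule inter_eqI[OF s r(1), rotated 2])
      fix w assume w: "w \<in> D s" "w \<in> D r"
      then have "w \<in> carrier A" using s dom_carrier by blast
      then show "w \<otimes> (v \<otimes> ?p) = w \<otimes> (v \<otimes> ?q)"
        using inter[of "w \<otimes> v"] w v vc s r p q by (simp add: dom_mult_right dom_mult_left mult_assoc)
    qed (use s r v vc p q in \<open>auto intro: dom_mult_right dom_mult_left\<close>)
  qed
  then show ?thesis by (simp add: r_def)
qed

text \<open>The product \<open>a M\<^sub>t(b)\<close> of an element with a multiplier on its right, which is the element
  \<open>(M\<^sub>t(b\<^sup>*)(a\<^sup>*))\<^sup>*\<close> of \<open>A\<close>. In a globalization it is \<open>a \<beta>\<^sub>t(b)\<close>.\<close>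

definition cross_mult :: "'g \<Rightarrow> 'a \<Rightarrow> 'a \<Rightarrow> 'a" where
  "cross_mult t a b = star A (local_mult t (star A b) (star A a))"

lemma cross_mult_mult:
  assumes "t \<in> carrier G" "a \<in> carrier A" "b \<in> carrier A" "y \<in> carrier A"
  shows "cross_mult t a b \<otimes> y = a \<otimes> local_mult t b y"
  using local_mult_adjoint[of t b "star A a" y] assms by (simp add: cross_mult_def)

lemma cross_mult_dom:
  assumes "t \<in> carrier G" "a \<in> carrier A" "b \<in> carrier A"
  shows "cross_mult t a b \<in> D t" "cross_mult t a b \<in> carrier A"
  unfolding cross_mult_def using assms by (auto intro!: dom_star local_mult_dom local_mult_closed)

text \<open>In a globalization this is \<open>\<beta>\<^sub>s(a \<beta>\<^sub>t(b)) = \<beta>\<^sub>s(a) \<beta>\<^sub>s\<^sub>t(b)\<close>. Put \<open>r = s t\<close> and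
  \<open>v = a M\<^sub>t(b)\<close>. It has to be shown that \<open>\<alpha>\<^sub>s(c v) y = \<alpha>\<^sub>s(c a) M\<^sub>r(b) y\<close> for
  \<open>c \<in> D (s\<^sup>-\<^sup>1)\<close>. Both sides lie in \<open>D s \<inter> D r\<close>, so they may be multiplied by
  \<open>w = \<alpha>\<^sub>s(f)\<close> with \<open>f \<in> D (s\<^sup>-\<^sup>1) \<inter> D t\<close>. Now \<open>f c a \<in> D t\<close> has the form \<open>\<alpha>\<^sub>t(h)\<close>, which gives
  \<open>f c v = \<alpha>\<^sub>t(h b)\<close>, and both products become \<open>\<alpha>\<^sub>r(h b) y\<close>.\<close>

lemma local_mult_cross_mult:
  assumes s: "s \<in> carrier G" and t: "t \<in> carrier G"
    and ab: "a \<in> carrier A" "b \<in> carrier A" and y: "y \<in> carrier A"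
  shows "local_mult s (cross_mult t a b) y = local_mult s a (local_mult (s \<otimes>\<^bsub>G\<^esub> t) b y)"
proof (rule local_mult_unique[OF s])
  define r v q where "r = s \<otimes>\<^bsub>G\<^esub> t" and "v = cross_mult t a b" and "q = local_mult r b y"
  have r: "r \<in> carrier G" "inv\<^bsub>G\<^esub> s \<in> carrier G" "inv\<^bsub>G\<^esub> t \<in> carrier G" "inv\<^bsub>G\<^esub> r \<in> carrier G"
    using s t by (simp_all add: r_def)
  have v: "v \<in> D t" "v \<in> carrier A" using cross_mult_dom[OF t ab] by (simp_all add: v_def)
  have q: "q \<in> D r" "q \<in> carrier A"
    using r ab y by (auto simp: q_def intro: local_mult_dom local_mult_closed)
  show "local_mult s a (local_mult (s \<otimes>\<^bsub>G\<^esub> t) b y) \<in> D s"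
    using s t ab y by (simp add: local_mult_dom)
  fix c assume c: "c \<in> D (inv\<^bsub>G\<^esub> s)"
  then have cc: "c \<in> carrier A" using r dom_carrier by blast
  have ca: "c \<otimes> a \<in> D (inv\<^bsub>G\<^esub> s)" and cv: "c \<otimes> v \<in> D (inv\<^bsub>G\<^esub> s)" "c \<otimes> v \<in> D t"
    using c cc ab v r t by (auto intro: dom_mult_right dom_mult_left)
  have "\<alpha> s (c \<otimes> a) \<otimes> q = \<alpha> s (c \<otimes> v) \<otimes> y"
  proof (rule inter_eqI[OF s r(1)])
    show "\<alpha> s (c \<otimes> v) \<otimes> y \<in> D r"
      using act_dom_inter[OF s t cv] y r by (auto simp: r_def intro: dom_mult_right)
    show "\<alpha> s (c \<otimes> v) \<otimes> y \<in> D s" "\<alpha> s (c \<otimes> a) \<otimes> q \<in> D s" "\<alpha> s (c \<otimes> a) \<otimes> q \<in> D r"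
      using s r cv ca q y by (auto intro: dom_mult_right dom_mult_left act_closed)
    fix w assume w: "w \<in> D s" "w \<in> D r"
    obtain f where f: "f \<in> D (inv\<^bsub>G\<^esub> s)" "f \<in> D t" "\<alpha> s f = w"
      using dom_inter_preimage[OF s t] w unfolding r_def by blast
    have fc: "f \<in> carrier A" using f t dom_carrier by blast
    define e where "e = f \<otimes> (c \<otimes> a)"
    have e: "e \<in> D (inv\<^bsub>G\<^esub> s)" "e \<in> D t" "e \<in> carrier A"
      using f fc cc ab t r by (auto simp: e_def intro: dom_mult_right)
    define h where "h = \<alpha> (inv\<^bsub>G\<^esub> t) e"
    have h: "h \<in> D (inv\<^bsub>G\<^esub> t)" "\<alpha> t h = e" 
      using t e(2) by (auto simp: h_def act_inv_closed act_act_inv)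
    have hc: "h \<in> carrier A" using h r dom_carrier by blast
    have h': "h \<in> D (inv\<^bsub>G\<^esub> r)" "\<alpha> s e = \<alpha> r h"
      using act_comp[OF s t h(1)] h e by (simp_all add: r_def)
    have hb: "h \<otimes> b \<in> D (inv\<^bsub>G\<^esub> t)" "h \<otimes> b \<in> D (inv\<^bsub>G\<^esub> r)"
      using h h' ab r by (auto intro: dom_mult_right)
    have fcv: "f \<otimes> (c \<otimes> v) = \<alpha> t (h \<otimes> b)"
    proof (rule nondegenerate_eqI_right)
      fix z assume z: "z \<in> carrier A"
      have "f \<otimes> (c \<otimes> v) \<otimes> z = f \<otimes> (c \<otimes> (v \<otimes> z))"
        using fc cc v z by (simp add: mult_assoc)
      also have "v \<otimes> z = a \<otimes> local_mult t b z"
        unfolding v_def using t ab z by (rule cross_mult_mult)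
      also have "f \<otimes> (c \<otimes> (a \<otimes> local_mult t b z)) = \<alpha> t h \<otimes> local_mult t b z"
        unfolding h(2) e_def using fc cc ab t z by (simp add: mult_assoc)
      also have "\<dots> = \<alpha> t (h \<otimes> b) \<otimes> z"
        by (rule act_local_mult[OF t ab(2) z h(1)])
      finally show "f \<otimes> (c \<otimes> v) \<otimes> z = \<alpha> t (h \<otimes> b) \<otimes> z" .
    qed (use t fc cc v hb in auto)
    have "w \<otimes> (\<alpha> s (c \<otimes> a) \<otimes> q) = \<alpha> s e \<otimes> q"
      using s f ca q by (simp flip: f(3) add: e_def act_mult mult_assoc)
    also have "\<dots> = \<alpha> r (h \<otimes> b) \<otimes> y"
      using r h' ab y by (simp add: q_def act_local_mult)
    also have "\<alpha> r (h \<otimes> b) = \<alpha> s (f \<otimes> (c \<otimes> v))"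
      using act_inter(2)[OF s t hb(1)] hb(2) by (simp add: r_def fcv)
    also have "\<dots> \<otimes> y = w \<otimes> (\<alpha> s (c \<otimes> v) \<otimes> y)"
      using s f cv y by (simp flip: f(3) add: act_mult mult_assoc)
    finally show "w \<otimes> (\<alpha> s (c \<otimes> a) \<otimes> q) = w \<otimes> (\<alpha> s (c \<otimes> v) \<otimes> y)" .
  qed
  then show "\<alpha> s c \<otimes> local_mult s a (local_mult (s \<otimes>\<^bsub>G\<^esub> t) b y) = \<alpha> s (c \<otimes> cross_mult t a b) \<otimes> y"
    using s ab c q by (simp add: act_local_mult q_def[unfolded r_def] r_def v_def)
qed

lemma local_mult_translate_imp_dom:
  assumes t: "t \<in> carrier G" and ab: "a \<in> carrier A" "b \<in> carrier A"
    and eq: "\<And>y. y \<in> carrier A \<Longrightarrow> a \<otimes> y = local_mult t b y"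
  shows "a \<in> D t"
  using dom_assimilative[OF t] local_mult_dom[OF t ab(2)] ab eq
  by (simp add: assimilative_def)

end

section \<open>The enveloping algebra\<close>

definition translate :: "('g, 'm) monoid_scheme \<Rightarrow> 'g \<Rightarrow> ('g \<Rightarrow> 'b) \<Rightarrow> ('g \<Rightarrow> 'b)" where
  "translate G t f = (\<lambda>s\<in>carrier G. f (s \<otimes>\<^bsub>G\<^esub> t))"

context globalizable_system
begin

abbreviation multiplier_functions :: "('g \<Rightarrow> 'a \<Rightarrow> 'a) star_alg" (\<open>\<C>\<close>) where
  "\<C> \<equiv> power_algebra (carrier G) (multiplier_algebra A)"

interpretation mult: plain_star_algebra "multiplier_algebra A"
  by (rule plain_star_algebra.intro[OF star_algebra_multiplier_algebra])

interpretation C: plain_star_algebra \<C>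
  by (rule plain_star_algebra.intro[OF mult.star_algebra_power_algebra])

lemma multiplier_functions_closed:
  assumes "f \<in> carrier \<C>" "s \<in> carrier G"
  shows "f s \<in> carrier (multiplier_algebra A)"
    and "x \<in> carrier A \<Longrightarrow> f s x \<in> carrier A"
proof -
  show *: "f s \<in> carrier (multiplier_algebra A)"
    using assms by (auto simp: power_algebra_def)
  show "x \<in> carrier A \<Longrightarrow> f s x \<in> carrier A"
    using * by (auto simp: multiplier_algebra_def adjoint_pair_def)
qed

lemma multiplier_functions_eqI:
  assumes f: "f \<in> carrier \<C>" and g: "g \<in> carrier \<C>"
    and eq: "\<And>s x. \<lbrakk>s \<in> carrier G; x \<in> carrier A\<rbrakk> \<Longrightarrow> f s x = g s x"
  shows "f = g"
proof (rule PiE_ext[of _ "carrier G" "\<lambda>_. carrier (multiplier_algebra A)"])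
  show "f \<in> carrier G \<rightarrow>\<^sub>E carrier (multiplier_algebra A)"
    "g \<in> carrier G \<rightarrow>\<^sub>E carrier (multiplier_algebra A)"
    using f g by (simp_all add: power_algebra_def)
  fix s assume s: "s \<in> carrier G"
  have "f s \<in> carrier A \<rightarrow>\<^sub>E carrier A" "g s \<in> carrier A \<rightarrow>\<^sub>E carrier A"
    using multiplier_functions_closed(1)[OF f s] multiplier_functions_closed(1)[OF g s]
    by (auto simp: multiplier_algebra_def adjoint_pair_def)
  then show "f s = g s" by (rule PiE_ext) (rule eq[OF s])
qed

lemma multiplier_functions_apply:
  assumes "s \<in> carrier G" "x \<in> carrier A"
  shows "(f \<otimes>\<^bsub>\<C>\<^esub> g) s x = f s (g s x)"
    and "(f \<oplus>\<^bsub>\<C>\<^esub> g) s x = f s x \<oplus> g s x"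
    and "(z \<odot>\<^bsub>\<C>\<^esub> f) s x = z \<odot> f s x"
    and "\<zero>\<^bsub>\<C>\<^esub> s x = \<zero>"
  using assms by (simp_all add: power_algebra_def multiplier_algebra_def compose_eq)

lemma translate_apply: "s \<in> carrier G \<Longrightarrow> translate G t f s = f (s \<otimes>\<^bsub>G\<^esub> t)"
  by (simp add: translate_def)

lemma translate_closed:
  assumes "t \<in> carrier G" "f \<in> carrier \<C>"
  shows "translate G t f \<in> carrier \<C>"
  using assms by (auto simp: power_algebra_def translate_def)

lemma translate_hom:
  assumes "t \<in> carrier G"
  shows "translate G t (f \<otimes>\<^bsub>\<C>\<^esub> g) = translate G t f \<otimes>\<^bsub>\<C>\<^esub> translate G t g"
    and "translate G t (f \<oplus>\<^bsub>\<C>\<^esub> g) = translate G t f \<oplus>\<^bsub>\<C>\<^esub> translate G t g"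
    and "translate G t (z \<odot>\<^bsub>\<C>\<^esub> f) = z \<odot>\<^bsub>\<C>\<^esub> translate G t f"
    and "translate G t (star \<C> f) = star \<C> (translate G t f)"
    and "translate G t \<zero>\<^bsub>\<C>\<^esub> = \<zero>\<^bsub>\<C>\<^esub>"
  using assms by (auto simp: power_algebra_def translate_def fun_eq_iff restrict_def)

lemma translate_translate:
  assumes "s \<in> carrier G" "t \<in> carrier G"
  shows "translate G s (translate G t f) = translate G (s \<otimes>\<^bsub>G\<^esub> t) f"
  using assms by (auto simp: translate_def fun_eq_iff G.m_assoc)

lemma translate_one:
  assumes "f \<in> carrier \<C>"
  shows "translate G \<one>\<^bsub>G\<^esub> f = f"
  by (rule multiplier_functions_eqI) (use assms in \<open>simp_all add: translate_closed translate_apply\<close>)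

lemma translate_inverse:
  assumes "t \<in> carrier G" "f \<in> carrier \<C>"
  shows "translate G t (translate G (inv\<^bsub>G\<^esub> t) f) = f" "translate G (inv\<^bsub>G\<^esub> t) (translate G t f) = f"
  using assms by (simp_all add: translate_translate translate_one)

text \<open>In a globalization, \<open>orbit_map a\<close> would be the orbit \<open>s \<mapsto> \<beta>\<^sub>s(a)\<close>, with \<open>\<beta>\<^sub>s(a)\<close> acting on \<open>A\<close>
  by left multiplication.\<close>

definition orbit_map :: "'a \<Rightarrow> 'g \<Rightarrow> 'a \<Rightarrow> 'a" where
  "orbit_map a = (\<lambda>s\<in>carrier G. \<lambda>x\<in>carrier A. local_mult s a x)"

lemma orbit_map_apply: "\<lbrakk>s \<in> carrier G; x \<in> carrier A\<rbrakk> \<Longrightarrow> orbit_map a s x = local_mult s a x"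
  by (simp add: orbit_map_def)

lemma adjoint_pair_orbit_map:
  assumes "s \<in> carrier G" "a \<in> carrier A"
  shows "adjoint_pair A (orbit_map a s) (orbit_map (star A a) s)"
  using assms by (auto simp: adjoint_pair_def orbit_map_def local_mult_adjoint)

lemma orbit_map_closed: "a \<in> carrier A \<Longrightarrow> orbit_map a \<in> carrier \<C>"
  using adjoint_pair_orbit_map by (auto simp: power_algebra_def multiplier_algebra_def orbit_map_def)

lemma orbit_map_star:
  assumes a: "a \<in> carrier A"
  shows "orbit_map (star A a) = star \<C> (orbit_map a)"
proof
  fix s
  show "orbit_map (star A a) s = star \<C> (orbit_map a) s"
    using adjoint_eq[OF adjoint_pair_orbit_map[OF _ a]]
    by (cases "s \<in> carrier G") (simp_all add: power_algebra_def multiplier_algebra_def orbit_map_def)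
qed

lemma orbit_map_add:
  assumes "a \<in> carrier A" "b \<in> carrier A"
  shows "orbit_map (a \<oplus> b) = orbit_map a \<oplus>\<^bsub>\<C>\<^esub> orbit_map b"
  by (rule multiplier_functions_eqI)
    (use assms in \<open>simp_all add: orbit_map_closed orbit_map_apply multiplier_functions_apply local_mult_add\<close>)

lemma orbit_map_smult:
  assumes "a \<in> carrier A"
  shows "orbit_map (z \<odot> a) = z \<odot>\<^bsub>\<C>\<^esub> orbit_map a"
  by (rule multiplier_functions_eqI)
    (use assms in \<open>simp_all add: orbit_map_closed orbit_map_apply multiplier_functions_apply local_mult_smult\<close>)

lemma orbit_map_mult:
  assumes "a \<in> carrier A" "b \<in> carrier A"
  shows "orbit_map (a \<otimes> b) = orbit_map a \<otimes>\<^bsub>\<C>\<^esub> orbit_map b"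
  by (rule multiplier_functions_eqI)
    (use assms in \<open>simp_all add: orbit_map_closed orbit_map_apply multiplier_functions_apply local_mult_mult\<close>)

lemma orbit_map_zero: "orbit_map \<zero> = \<zero>\<^bsub>\<C>\<^esub>"
proof -
  have "orbit_map \<zero> = orbit_map (0 \<odot> \<zero>)"
    by (simp flip: zero_eq_smult)
  also have "\<dots> = 0 \<odot>\<^bsub>\<C>\<^esub> orbit_map \<zero>"
    by (rule orbit_map_smult) simp
  also have "\<dots> = \<zero>\<^bsub>\<C>\<^esub>"
    using C.zero_eq_smult[of "orbit_map \<zero>"] by (simp add: orbit_map_closed)
  finally show ?thesis .
qed

lemma orbit_map_inj: "inj_on orbit_map (carrier A)"
proof (rule inj_onI)
  fix a b assume ab: "a \<in> carrier A" "b \<in> carrier A" and eq: "orbit_map a = orbit_map b"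
  show "a = b"
  proof (rule nondegenerate_eqI_right)
    fix x assume x: "x \<in> carrier A"
    have "orbit_map a \<one>\<^bsub>G\<^esub> x = orbit_map b \<one>\<^bsub>G\<^esub> x" by (simp add: eq)
    then show "a \<otimes> x = b \<otimes> x" using ab x by (simp add: orbit_map_apply local_mult_one)
  qed (use ab in auto)
qed

lemma orbit_map_act:
  assumes "t \<in> carrier G" "x \<in> D (inv\<^bsub>G\<^esub> t)"
  shows "orbit_map (\<alpha> t x) = translate G t (orbit_map x)"
proof -
  have "x \<in> carrier A" using assms dom_carrier[of "inv\<^bsub>G\<^esub> t" x] by simp
  then show ?thesis
    by (intro multiplier_functions_eqI)
      (use assms in \<open>simp_all add: orbit_map_closed translate_closed orbit_map_apply translate_apply local_mult_act\<close>)
qed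

lemma orbit_map_eq_translate_imp_dom:
  assumes t: "t \<in> carrier G" and ab: "a \<in> carrier A" "b \<in> carrier A"
    and eq: "orbit_map a = translate G t (orbit_map b)"
  shows "a \<in> D t"
proof (rule local_mult_translate_imp_dom[OF t ab])
  fix y assume y: "y \<in> carrier A"
  have "orbit_map a \<one>\<^bsub>G\<^esub> y = translate G t (orbit_map b) \<one>\<^bsub>G\<^esub> y" by (simp add: eq)
  then show "a \<otimes> y = local_mult t b y"
    using t ab y by (simp add: orbit_map_apply translate_apply local_mult_one)
qed

text \<open>The algebraic core of the ideal property: the product of an element of the copy of \<open>A\<close> with
  a translate of the copy falls back into the copy.\<close>

lemma orbit_map_mult_translate:
  assumes t: "t \<in> carrier G" and ab: "a \<in> carrier A" "b \<in> carrier A"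
  shows "orbit_map a \<otimes>\<^bsub>\<C>\<^esub> translate G t (orbit_map b) = orbit_map (cross_mult t a b)"
  by (rule multiplier_functions_eqI)
    (use assms cross_mult_dom in \<open>simp_all add: orbit_map_closed translate_closed orbit_map_apply
      translate_apply multiplier_functions_apply local_mult_cross_mult\<close>)

definition translates :: "('g \<Rightarrow> 'a \<Rightarrow> 'a) set" where
  "translates = (\<Union>t\<in>carrier G. translate G t ` orbit_map ` carrier A)"

definition enveloping_algebra :: "('g \<Rightarrow> 'a \<Rightarrow> 'a) star_alg" (\<open>\<B>\<close>) where
  "\<B> = \<C>\<lparr>carrier := linear_span \<C> translates\<rparr>"

lemma enveloping_algebra_simps [simp]:
  "monoid.mult \<B> = monoid.mult \<C>" "add \<B> = add \<C>" "zero \<B> = zero \<C>"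
  "smult \<B> = smult \<C>" "star \<B> = star \<C>" "carrier \<B> = linear_span \<C> translates"
  by (simp_all add: enveloping_algebra_def)

lemma translatesE:
  assumes "f \<in> translates"
  obtains t a where "t \<in> carrier G" "a \<in> carrier A" "f = translate G t (orbit_map a)"
  using assms by (auto simp: translates_def)

lemma translates_closed: "translates \<subseteq> carrier \<C>"
  by (auto elim!: translatesE intro: translate_closed orbit_map_closed)

lemma translate_orbit_map_span:
  "\<lbrakk>t \<in> carrier G; a \<in> carrier A\<rbrakk> \<Longrightarrow> translate G t (orbit_map a) \<in> linear_span \<C> translates"
  using C.linear_span_superset[of translates] by (auto simp: translates_def)

lemma orbit_map_span: "a \<in> carrier A \<Longrightarrow> orbit_map a \<in> linear_span \<C> translates"
  using translate_orbit_map_span[of "\<one>\<^bsub>G\<^esub>" a] by (simp add: translate_one orbit_map_closed)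

lemma span_submodule: "submodule (linear_span \<C> translates) complex_ring \<C>"
  using translates_closed by (rule C.submodule_linear_span)

lemma span_closed:
  shows span_carrier: "f \<in> linear_span \<C> translates \<Longrightarrow> f \<in> carrier \<C>"
    and span_zero: "\<zero>\<^bsub>\<C>\<^esub> \<in> linear_span \<C> translates"
    and span_add: "\<lbrakk>f \<in> linear_span \<C> translates; g \<in> linear_span \<C> translates\<rbrakk>
      \<Longrightarrow> f \<oplus>\<^bsub>\<C>\<^esub> g \<in> linear_span \<C> translates"
    and span_smult: "f \<in> linear_span \<C> translates \<Longrightarrow> z \<odot>\<^bsub>\<C>\<^esub> f \<in> linear_span \<C> translates"
  using span_submodule unfolding C.submodule_iff by blast+

lemma span_induct [consumes 1, case_names translate zero add smult]:
  assumes "f \<in> linear_span \<C> translates"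
    and "\<And>t a. \<lbrakk>t \<in> carrier G; a \<in> carrier A\<rbrakk> \<Longrightarrow> P (translate G t (orbit_map a))" and "P \<zero>\<^bsub>\<C>\<^esub>"
    and "\<And>f g. \<lbrakk>f \<in> carrier \<C>; g \<in> carrier \<C>; P f; P g\<rbrakk> \<Longrightarrow> P (f \<oplus>\<^bsub>\<C>\<^esub> g)"
    and "\<And>z f. \<lbrakk>f \<in> carrier \<C>; P f\<rbrakk> \<Longrightarrow> P (z \<odot>\<^bsub>\<C>\<^esub> f)"
  shows "P f"
  using assms(1) translates_closed
  by (rule C.linear_span_induct) (use assms(2-5) in \<open>auto elim: translatesE\<close>)

lemma span_translate:
  assumes f: "f \<in> linear_span \<C> translates" and t: "t \<in> carrier G"
  shows "translate G t f \<in> linear_span \<C> translates"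
  using f by (induction rule: span_induct)
    (use t in \<open>simp_all add: translate_translate translate_orbit_map_span translate_hom span_closed\<close>)

lemma span_star:
  assumes f: "f \<in> linear_span \<C> translates"
  shows "star \<C> f \<in> linear_span \<C> translates"
  using f
proof (induction rule: span_induct)
  case (translate t a)
  then have "star \<C> (translate G t (orbit_map a)) = translate G t (orbit_map (star A a))"
    by (simp add: translate_hom orbit_map_star)
  then show ?case using translate by (simp add: translate_orbit_map_span)
qed (simp_all add: C.star_add C.star_smult span_closed)

lemma orbit_map_mult_span:
  assumes f: "f \<in> linear_span \<C> translates" and a: "a \<in> carrier A"
  shows "orbit_map a \<otimes>\<^bsub>\<C>\<^esub> f \<in> orbit_map ` carrier A"
  using f
proof (induction rule: span_induct)
  case (translate t b)
  then show ?case using a cross_mult_dom by (simp add: orbit_map_mult_translate)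
next
  case zero
  have "orbit_map a \<otimes>\<^bsub>\<C>\<^esub> \<zero>\<^bsub>\<C>\<^esub> = orbit_map \<zero>"
    using a by (simp add: orbit_map_zero orbit_map_closed)
  then show ?case by blast
next
  case (add f g)
  then obtain b c where bc: "b \<in> carrier A" "c \<in> carrier A"
    "orbit_map a \<otimes>\<^bsub>\<C>\<^esub> f = orbit_map b" "orbit_map a \<otimes>\<^bsub>\<C>\<^esub> g = orbit_map c" by auto
  then have "orbit_map a \<otimes>\<^bsub>\<C>\<^esub> (f \<oplus>\<^bsub>\<C>\<^esub> g) = orbit_map (b \<oplus> c)"
    using add a by (simp add: C.mult_distr_r orbit_map_closed orbit_map_add)
  then show ?case using bc by blast
next
  case (smult z f)
  then obtain b where b: "b \<in> carrier A" "orbit_map a \<otimes>\<^bsub>\<C>\<^esub> f = orbit_map b" by auto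
  then have "orbit_map a \<otimes>\<^bsub>\<C>\<^esub> (z \<odot>\<^bsub>\<C>\<^esub> f) = orbit_map (z \<odot> b)"
    using smult a by (simp add: C.mult_smult_r orbit_map_closed orbit_map_smult)
  then show ?case using b by blast
qed

text \<open>Translating back by \<open>t\<^sup>-\<^sup>1\<close> reduces products of generators to products with an element of the
  copy of \<open>A\<close>, which is a right ideal.\<close>

lemma span_mult:
  assumes f: "f \<in> linear_span \<C> translates" and g: "g \<in> linear_span \<C> translates"
  shows "f \<otimes>\<^bsub>\<C>\<^esub> g \<in> linear_span \<C> translates"
  using f
proof (induction rule: span_induct)
  case (translate t a)
  have "orbit_map a \<otimes>\<^bsub>\<C>\<^esub> translate G (inv\<^bsub>G\<^esub> t) g \<in> orbit_map ` carrier A"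
    using translate g by (simp add: orbit_map_mult_span span_translate)
  then have "translate G t (orbit_map a \<otimes>\<^bsub>\<C>\<^esub> translate G (inv\<^bsub>G\<^esub> t) g) \<in> linear_span \<C> translates"
    using translate by (auto intro: translate_orbit_map_span)
  then show ?case
    using translate span_carrier[OF g] by (simp add: translate_hom translate_inverse)
qed (use span_carrier[OF g] in \<open>simp_all add: C.mult_distr_l C.mult_smult_l span_closed\<close>)

lemma star_algebra_enveloping_algebra: "star_algebra \<B>"
  unfolding enveloping_algebra_def
  by (rule C.star_algebra_restrict_carrier[OF span_submodule span_mult span_star])

interpretation B: plain_star_algebra \<B>
  by (rule plain_star_algebra.intro[OF star_algebra_enveloping_algebra])

lemma star_ideal_orbit_map: "star_ideal (orbit_map ` carrier A) \<B>"
  unfolding B.star_ideal_iff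
proof (intro conjI ballI allI)
  have "\<zero>\<^bsub>\<B>\<^esub> = orbit_map \<zero>" by (simp add: orbit_map_zero)
  then show "\<zero>\<^bsub>\<B>\<^esub> \<in> orbit_map ` carrier A" by blast
qed (auto simp: orbit_map_span orbit_map_mult_span orbit_map_add[symmetric] orbit_map_smult[symmetric]
    orbit_map_star[symmetric])

lemma star_global_action_translate: "star_global_action G \<B> (translate G)"
  unfolding star_global_action_def star_partial_action_def partial_action_def
proof (intro conjI ballI allI impI)
  show "star_ideal (carrier \<B>) \<B>"
    unfolding B.star_ideal_iff by (auto simp: span_closed span_mult span_star)
  show "star_hom (\<B>\<lparr>carrier := carrier \<B>\<rparr>) (\<B>\<lparr>carrier := carrier \<B>\<rparr>) (translate G t)"
    if "t \<in> carrier G" for t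
    using that by (auto simp: star_hom_def translate_hom span_translate)
qed (auto simp: span_translate translate_one translate_translate dest: span_carrier)

text \<open>The inclusion from left to right rests on assimilativity, the other one on equivariance at
  \<open>\<alpha>\<^sub>t\<^sup>-\<^sup>1(x)\<close>.\<close>

lemma restr_dom_orbit_map:
  assumes t: "t \<in> carrier G"
  shows "restr_dom (translate G) (orbit_map ` carrier A) t = orbit_map ` D t"
proof
  show "restr_dom (translate G) (orbit_map ` carrier A) t \<subseteq> orbit_map ` D t"
    using orbit_map_eq_translate_imp_dom[OF t] by (auto simp: restr_dom_def)
  show "orbit_map ` D t \<subseteq> restr_dom (translate G) (orbit_map ` carrier A) t"
  proof
    fix f assume "f \<in> orbit_map ` D t"
    then obtain x where x: "x \<in> D t" "f = orbit_map x" by auto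
    have "f = translate G t (orbit_map (\<alpha> (inv\<^bsub>G\<^esub> t) x))"
      using t x by (simp add: orbit_map_act[symmetric] act_inv_closed act_act_inv)
    moreover have "\<alpha> (inv\<^bsub>G\<^esub> t) x \<in> carrier A" "x \<in> carrier A"
      using t x act_inv_closed[OF t x(1)] dom_carrier[of "inv\<^bsub>G\<^esub> t"] dom_carrier[OF t] by auto
    ultimately show "f \<in> restr_dom (translate G) (orbit_map ` carrier A) t"
      unfolding restr_dom_def using x(2) by blast
  qed
qed

lemma restr_map_orbit_map:
  assumes t: "t \<in> carrier G" and x: "x \<in> D (inv\<^bsub>G\<^esub> t)"
  shows "restr_map G (translate G) (orbit_map ` carrier A) t (orbit_map x) = orbit_map (\<alpha> t x)"
proof -
  have "orbit_map x \<in> restr_dom (translate G) (orbit_map ` carrier A) (inv\<^bsub>G\<^esub> t)"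
    using t x by (simp add: restr_dom_orbit_map)
  then show ?thesis
    using t x by (simp add: restr_map_def restr_dom_def orbit_map_act)
qed

lemma star_isomorphism_orbit_map:
  "star_isomorphism G A D \<alpha> (\<B>\<lparr>carrier := orbit_map ` carrier A\<rparr>)
     (restr_dom (translate G) (orbit_map ` carrier A))
     (restr_map G (translate G) (orbit_map ` carrier A)) orbit_map"
proof -
  define g where "g = inv_into (carrier A) orbit_map"
  have g [simp]: "g (orbit_map a) = a" if "a \<in> carrier A" for a
    using orbit_map_inj that by (simp add: g_def)
  have g_dom: "g (orbit_map x) = x" if "t \<in> carrier G" "x \<in> D t" for t x
    using that dom_carrier by simp
  show ?thesis
    unfolding star_isomorphism_def star_morphism_def
  proof (intro conjI exI[of _ g] ballI)
    show "star_hom A (\<B>\<lparr>carrier := orbit_map ` carrier A\<rparr>) orbit_map"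
      by (auto simp: star_hom_def orbit_map_add orbit_map_smult orbit_map_mult orbit_map_star)
    show "star_hom (\<B>\<lparr>carrier := orbit_map ` carrier A\<rparr>) A g"
      by (auto simp: star_hom_def orbit_map_add[symmetric] orbit_map_smult[symmetric]
          orbit_map_mult[symmetric] orbit_map_star[symmetric])
    fix t assume t: "t \<in> carrier G"
    show "orbit_map ` D t \<subseteq> restr_dom (translate G) (orbit_map ` carrier A) t"
      using t by (simp add: restr_dom_orbit_map)
    show "g ` restr_dom (translate G) (orbit_map ` carrier A) t \<subseteq> D t"
      using t g_dom[OF t] by (auto simp: restr_dom_orbit_map)
    show "orbit_map (\<alpha> t x) = restr_map G (translate G) (orbit_map ` carrier A) t (orbit_map x)"
      if "x \<in> D (inv\<^bsub>G\<^esub> t)" for x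
      using t that by (simp add: restr_map_orbit_map)
    show "g (restr_map G (translate G) (orbit_map ` carrier A) t f) = \<alpha> t (g f)"
      if f: "f \<in> restr_dom (translate G) (orbit_map ` carrier A) (inv\<^bsub>G\<^esub> t)" for f
    proof -
      obtain x where "x \<in> D (inv\<^bsub>G\<^esub> t)" "f = orbit_map x"
        using f t by (auto simp: restr_dom_orbit_map)
      then show ?thesis
        using t g_dom[of "inv\<^bsub>G\<^esub> t" x] by (simp add: restr_map_orbit_map)
    qed
  qed auto
qed

theorem star_globalization_enveloping_algebra:
  "star_globalization G A D \<alpha> \<B> (translate G) (orbit_map ` carrier A) orbit_map"
  unfolding star_globalization_def
  by (intro conjI star_algebra_enveloping_algebra star_global_action_translate star_ideal_orbit_map
      star_isomorphism_orbit_map)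

text \<open>Testing \<open>f\<close> against the translate by \<open>s\<^sup>-\<^sup>1\<close> of \<open>orbit_map x\<close> exposes the value at \<open>s\<close>, where
  the translate is left multiplication by \<open>x\<close>.\<close>

lemma nondegenerate_enveloping_algebra: "nondegenerate \<B>"
  unfolding nondegenerate_def
proof (intro ballI impI)
  fix f assume "f \<in> carrier \<B>" and zero: "\<forall>g\<in>carrier \<B>. f \<otimes>\<^bsub>\<B>\<^esub> g = \<zero>\<^bsub>\<B>\<^esub>"
  then have f: "f \<in> carrier \<C>" by (simp add: span_carrier)
  have "f s x = \<zero>\<^bsub>\<C>\<^esub> s x" if s: "s \<in> carrier G" and x: "x \<in> carrier A" for s x
  proof (rule nondegenerate_eqI_right)
    show "f s x \<in> carrier A" "\<zero>\<^bsub>\<C>\<^esub> s x \<in> carrier A"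
      using s x f by (simp_all add: multiplier_functions_closed)
    fix y assume y: "y \<in> carrier A"
    obtain n where n: "adjoint_pair A (f s) n"
      using multiplier_functions_closed(1)[OF f s] by (rule multiplier_carrierE)
    have "translate G (inv\<^bsub>G\<^esub> s) (orbit_map x) \<in> carrier \<B>"
      using s x by (simp add: translate_orbit_map_span)
    then have "(f \<otimes>\<^bsub>\<C>\<^esub> translate G (inv\<^bsub>G\<^esub> s) (orbit_map x)) s y = \<zero>\<^bsub>\<C>\<^esub> s y"
      using zero by simp
    then have "f s (x \<otimes> y) = \<zero>"
      using s x y by (simp add: multiplier_functions_apply translate_apply orbit_map_apply local_mult_one)
    then show "f s x \<otimes> y = \<zero>\<^bsub>\<C>\<^esub> s x \<otimes> y"
      using multiplier_mult[OF n x y] s x y by (simp add: multiplier_functions_apply)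
  qed
  then show "f = \<zero>\<^bsub>\<B>\<^esub>" using f by (simp add: multiplier_functions_eqI)
qed

text \<open>The span is formed here inside \<open>\<B>\<close> rather than inside \<open>\<C>\<close>; a subspace of \<open>\<B>\<close> is a subspace
  of \<open>\<C>\<close>, so the result is the same.\<close>

lemma minimal_enveloping_algebra: "minimal_globalization G \<B> (translate G) (orbit_map ` carrier A)"
  unfolding minimal_globalization_def translates_def[symmetric]
proof
  have sub: "translates \<subseteq> carrier \<B>"
    using C.linear_span_superset by simp
  show "linear_span \<B> translates \<subseteq> carrier \<B>"
    using B.submodule_linear_span[OF sub] unfolding B.submodule_iff by blast
  have "submodule (linear_span \<B> translates) complex_ring \<C>"
    using B.submodule_linear_span[OF sub] span_carrier
    unfolding B.submodule_iff C.submodule_iff by auto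
  then have "linear_span \<C> translates \<subseteq> linear_span \<B> translates"
    by (intro C.linear_span_minimal B.linear_span_superset)
  then show "carrier \<B> \<subseteq> linear_span \<B> translates" by simp
qed

end

section \<open>Existence of globalizations\<close>

theorem theorem2p16:
  fixes G :: "('g, 'm) monoid_scheme"
    and A :: "'a star_alg"
    and D :: "'g \<Rightarrow> 'a set"
    and \<alpha> :: "'g \<Rightarrow> 'a \<Rightarrow> 'a"
  assumes "group G"
    and "star_algebra A"
    and "star_partial_action G A D \<alpha>"
  shows "(has_star_globalization TYPE('b) G A D \<alpha> \<longrightarrow> multiplier_condition G A D \<alpha>) \<and>
    ((\<forall>s\<in>carrier G. \<forall>t\<in>carrier G.
        nondegenerate (A\<lparr>carrier := D t <+>\<^bsub>A\<^esub> D s\<rparr>) \<and>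
        nondegenerate (A\<lparr>carrier := D t \<inter> D s\<rparr>) \<and>
        assimilative (D t) A) \<longrightarrow>
      multiplier_condition G A D \<alpha> \<longrightarrow>
      has_star_globalization TYPE('g \<Rightarrow> 'a \<Rightarrow> 'a) G A D \<alpha> \<and>
      (\<exists>(B :: ('g \<Rightarrow> 'a \<Rightarrow> 'a) star_alg) \<beta> I \<iota>.
        star_globalization G A D \<alpha> B \<beta> I \<iota> \<and> nondegenerate B \<and> minimal_globalization G B \<beta> I))"
    (is "?necessary \<and> (?H \<longrightarrow> ?M \<longrightarrow> ?sufficient)")
proof (intro conjI impI)
  interpret star_partial_system G A D \<alpha>
    using assms by (intro star_partial_system.intro plain_star_algebra.intro
        star_partial_system_axioms.intro)
  show ?M if "has_star_globalization TYPE('b) G A D \<alpha>"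
    using that star_globalization_imp_multiplier_condition
    unfolding has_star_globalization_def by blast
  assume ?H ?M
  then interpret globalizable_system G A D \<alpha>
    by unfold_locales auto
  show "has_star_globalization TYPE('g \<Rightarrow> 'a \<Rightarrow> 'a) G A D \<alpha>"
    using star_globalization_enveloping_algebra unfolding has_star_globalization_def by blast
  show "\<exists>(B :: ('g \<Rightarrow> 'a \<Rightarrow> 'a) star_alg) \<beta> I \<iota>.
      star_globalization G A D \<alpha> B \<beta> I \<iota> \<and> nondegenerate B \<and> minimal_globalization G B \<beta> I"
    using star_globalization_enveloping_algebra nondegenerate_enveloping_algebra
      minimal_enveloping_algebra by blast
qed

end
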